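(* Let $Y<2$, $C>0$, $M>0$, and let $X$ be the centered infinitely divisible random variable with no Gaussian part and Lévy measure $\nu(dx)=Cx^{-1-Y}e^{-Mx}\,dx$ on $(0,\infty)$ (so $V=C\,\Gamma(2-Y)M^{Y-2}$ and $\tau=M$). Then $$c_*(V)=\frac1M\max\Bigl\{1,\ \frac{2-Y}{3}\Bigr\},$$ with local control for $Y\le-1$ (i.e. $c_*(V)=\lim_{t\downarrow0}\Psi_1(t)$) and boundary control for $Y\ge-1$ (i.e. $c_*(V)=1/\tau$). Moreover the frontier $v\mapsto c_*(v)$ is constant on $[V,\infty)$ for $Y\ge-1$, while for $Y<-1$ it decreases from $c_*(V)=\frac{2-Y}{3M}$ to the floor $1/M$: $c_*$ is nonincreasing on $[V,\infty)$, $c_*(v)<c_*(V)$ for every $v>V$, and $c_*(v)\to1/M$ as $v\to\infty$.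
   Context: For a centered, nondegenerate, infinitely divisible real random variable $X$ with variance $0<V<\infty$, Gaussian variance $a\ge0$ and Lévy measure $\nu$: for all real $t$, $K_X(t)=\log\mathbb{E}e^{tX}=\frac{at^2}{2}+\int_{\mathbb{R}\setminus\{0\}}(e^{tx}-1-tx)\,\nu(dx)\in[0,\infty]$, $V=a+\int x^2\,\nu(dx)$, and $\tau=\sup\{t>0:K_X(t)<\infty\}$. Let $H_X(dx)=a\delta_0(dx)+x^2\nu(dx)$ (total mass $V$), let $Z$ have law $H_X/V$, let $B\sim\mathrm{Beta}(1,2)$ (density $2(1-b)$ on $(0,1)$) be independent of $Z$, and put $R=BZ$, $M_R(t)=\mathbb{E}e^{tR}\in(0,\infty]$. $\Psi_1(t)=\frac1t\bigl(1-\frac{1}{M_R(t)}\bigr)$ for $t>0$, with $1/\infty=0$. A pair $(v,c)\in(0,\infty)\times[0,\infty)$ is feasible for $X$ if $K_X(t)\le \frac{vt^2}{2(1-ct)}$ for every $0\le t<1/c$ (with $1/0=\infty$; for $c=0$: for all $t\ge0$). $c_*(v)=\inf\{c\ge0:(v,c)\text{ is feasible}\}\in[0,\infty]$, with $\inf\emptyset=\infty$. *)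

theory Defs
  imports "HOL-Probability.Probability"
begin

definition infinitely_divisible :: "real measure \<Rightarrow> bool" where
  "infinitely_divisible \<mu> \<longleftrightarrow>
     (\<forall>n::nat. n \<ge> 1 \<longrightarrow> (\<exists>\<mu>\<^sub>n. real_distribution \<mu>\<^sub>n \<and>
        \<mu> = distr (Pi\<^sub>M {..<n} (\<lambda>_. \<mu>\<^sub>n)) borel (\<lambda>\<omega>. \<Sum>i<n. \<omega> i)))"

definition finite_variance_levy_measure :: "real measure \<Rightarrow> bool" where
  "finite_variance_levy_measure \<nu> \<longleftrightarrow>
     sets \<nu> = sets borel \<and> emeasure \<nu> {0} = 0 \<and> (\<integral>\<^sup>+ x. ennreal (x\<^sup>2) \<partial>\<nu>) < \<infinity>"

(* X is a centered, nondegenerate, infinitely divisible variable of finite variance, with Gaussian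
   variance a and Levy measure nu. These characteristics are identified by the Levy-Khintchine
   formula for the characteristic function; since the variance is finite, it can be
   written with the compensator i*u*x for all x, and then there is no drift term for centered X.
   The formula for the exponential moments of X is a consequence and is not part of
   the definition. *)
definition centered_inf_div_rv ::
    "'a measure \<Rightarrow> ('a \<Rightarrow> real) \<Rightarrow> real \<Rightarrow> real measure \<Rightarrow> bool" where
  "centered_inf_div_rv P X a \<nu> \<longleftrightarrow>
     prob_space P \<and> X \<in> borel_measurable P \<and>
     integrable P X \<and> integrable P (\<lambda>\<omega>. (X \<omega>)\<^sup>2) \<and>
     prob_space.expectation P X = 0 \<and> prob_space.variance P X > 0 \<and>
     infinitely_divisible (distr P borel X) \<and>
     a \<ge> 0 \<and> finite_variance_levy_measure \<nu> \<and>
     (\<forall>u. char (distr P borel X) u =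
        exp (- complex_of_real (a * u\<^sup>2 / 2) +
             (CLINT x|\<nu>. iexp (u * x) - 1 - \<i> * complex_of_real (u * x))))"

definition mgf :: "'a measure \<Rightarrow> ('a \<Rightarrow> real) \<Rightarrow> real \<Rightarrow> ennreal" where
  "mgf P X t = (\<integral>\<^sup>+ \<omega>. ennreal (exp (t * X \<omega>)) \<partial>P)"

(* log E exp(tX); on a probability space the mgf is never 0. *)
definition cgf :: "'a measure \<Rightarrow> ('a \<Rightarrow> real) \<Rightarrow> real \<Rightarrow> ereal" where
  "cgf P X t = (if mgf P X t = \<infinity> then \<infinity> else ereal (ln (enn2real (mgf P X t))))"

(* sup {t > 0. K_X(t) < infinity}; the inserted 0 only fixes the value for the empty set,
   which would be -infinity in the type ereal. *)
definition cgf_abscissa :: "'a measure \<Rightarrow> ('a \<Rightarrow> real) \<Rightarrow> ereal" where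
  "cgf_abscissa P X = Sup (insert 0 {ereal t | t. t > 0 \<and> cgf P X t < \<infinity>})"

(* a * delta_0 + x^2 nu(dx) *)
definition H_measure :: "real \<Rightarrow> real measure \<Rightarrow> real measure" where
  "H_measure a \<nu> = measure_of UNIV (sets borel)
     (\<lambda>A. ennreal a * indicator A 0 + (\<integral>\<^sup>+ x\<in>A. ennreal (x\<^sup>2) \<partial>\<nu>))"

lemma emeasure_H_measure:
  assumes "sets \<nu> = sets borel" "A \<in> sets borel"
  shows "emeasure (H_measure a \<nu>) A =
    ennreal a * indicator A 0 + (\<integral>\<^sup>+ x\<in>A. ennreal (x\<^sup>2) \<partial>\<nu>)"
proof -
  let ?f = "\<lambda>A. ennreal a * indicator A (0::real) + (\<integral>\<^sup>+ x\<in>A. ennreal (x\<^sup>2) \<partial>\<nu>)"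
  have [measurable_cong]: "sets \<nu> = sets borel" by fact
  have eq: "?f B = ennreal a * emeasure (return borel 0) B
      + emeasure (density \<nu> (\<lambda>x. ennreal (x\<^sup>2))) B" if "B \<in> sets borel" for B
    using that by (simp add: emeasure_density assms(1))
  show ?thesis
  proof (rule emeasure_measure_of[OF H_measure_def])
    show "countably_additive (sets (H_measure a \<nu>)) ?f"
    proof (rule countably_additiveI)
      fix F :: "nat \<Rightarrow> real set"
      assume F: "range F \<subseteq> sets (H_measure a \<nu>)" "disjoint_family F"
      have s: "sets (H_measure a \<nu>) = sets borel"
        unfolding H_measure_def by (simp add: sets_measure_of_conv sigma_algebra.sigma_sets_eq
            sets.sigma_sets_eq[of borel, simplified])
      have Fb: "range F \<subseteq> sets borel" using F s by simp
      have "(\<Sum>i. ?f (F i)) = (\<Sum>i. ennreal a * emeasure (return borel 0) (F i)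
          + emeasure (density \<nu> (\<lambda>x. ennreal (x\<^sup>2))) (F i))"
        using Fb by (intro suminf_cong eq) auto
      also have "\<dots> = (\<Sum>i. ennreal a * emeasure (return borel 0) (F i))
          + (\<Sum>i. emeasure (density \<nu> (\<lambda>x. ennreal (x\<^sup>2))) (F i))"
        by (rule suminf_add[symmetric]) auto
      also have "\<dots> = ennreal a * emeasure (return borel 0) (\<Union>i. F i)
          + emeasure (density \<nu> (\<lambda>x. ennreal (x\<^sup>2))) (\<Union>i. F i)"
        using Fb F(2) by (subst ennreal_suminf_cmult)
          (simp add: suminf_emeasure assms(1) del: emeasure_return)
      also have "\<dots> = ?f (\<Union>i. F i)"
        by (rule eq[symmetric]) (use Fb in auto)
      finally show "(\<Sum>i. ?f (F i)) = ?f (\<Union>i. F i)" .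
    qed
  qed (use assms in \<open>auto simp: positive_def H_measure_def sets_measure_of_conv
        sets.sigma_sets_eq[of borel, simplified]\<close>)
qed

(* H_X / V, where V is the total mass of H_X, equal to the variance of X *)
definition Z_law :: "real \<Rightarrow> real measure \<Rightarrow> real measure" where
  "Z_law a \<nu> = scale_measure (1 / emeasure (H_measure a \<nu>) UNIV) (H_measure a \<nu>)"

definition beta_1_2_law :: "real measure" where
  "beta_1_2_law = density lborel (\<lambda>b. ennreal (2 * (1 - b)) * indicator {0<..<1} b)"

(* Law of R = B * Z for independent B and Z *)
definition R_law :: "real \<Rightarrow> real measure \<Rightarrow> real measure" where
  "R_law a \<nu> = distr (beta_1_2_law \<Otimes>\<^sub>M Z_law a \<nu>) borel (\<lambda>(b, z). b * z)"

(* Division in ennreal satisfies 1 / infinity = 0. *)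
definition Psi1 :: "real \<Rightarrow> real measure \<Rightarrow> real \<Rightarrow> real" where
  "Psi1 a \<nu> t = (1 / t) * (1 - enn2real (1 / mgf (R_law a \<nu>) (\<lambda>r. r) t))"

(* For c \<ge> 0 the condition t < 1/c, with 1/0 = infinity, is c * t < 1. *)
definition feasible :: "'a measure \<Rightarrow> ('a \<Rightarrow> real) \<Rightarrow> real \<Rightarrow> real \<Rightarrow> bool" where
  "feasible P X v c \<longleftrightarrow> v > 0 \<and> c \<ge> 0 \<and>
     (\<forall>t\<ge>0. c * t < 1 \<longrightarrow> cgf P X t \<le> ereal (v * t\<^sup>2 / (2 * (1 - c * t))))"

(* The infimum of the empty set is infinity. *)
definition c_star :: "'a measure \<Rightarrow> ('a \<Rightarrow> real) \<Rightarrow> real \<Rightarrow> ereal" where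
  "c_star P X v = Inf {ereal c | c. feasible P X v c}"

definition tempered_stable_levy :: "real \<Rightarrow> real \<Rightarrow> real \<Rightarrow> real measure" where
  "tempered_stable_levy Y C M =
     density lborel (\<lambda>x. ennreal (C * x powr (- 1 - Y) * exp (- M * x)) * indicator {0<..} x)"

end

theory Submission
  imports Defs
begin

text \<open>
Write \<open>p = 2 - Y\<close>. The measure \<open>x\<^sup>2 \<nu>(dx)\<close> is a multiple of the gamma law with shape \<open>p\<close> and rate \<open>M\<close>, so the second
derivative of the cumulant generating function \<open>K\<close> is \<open>V (1 - t / M)\<^bsup>-p\<^esup>\<close> on \<open>[0, M)\<close>. Integrating twice,
\<open>K(t) = V t\<^sup>2 A(t) / 2\<close> where \<open>A\<close>, called \<open>cgf_ratio\<close> below, is the mixture of \<open>(1 - b t / M)\<^bsup>-p\<^esup>\<close> over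
\<open>b\<close> with the Beta(1,2) law, and equals the moment generating function of \<open>R\<close>. Two elementary bounds govern
everything: \<open>1 + (p / 3) (t / M) \<le> A(t)\<close>, exact to first order, and \<open>A(t) \<le> 1 / (1 - k t / M)\<close> for
\<open>k = max 1 (p / 3)\<close>. The second one holds because \<open>(1 - x)\<^bsup>-p\<^esup> \<le> (1 - k x)\<^bsup>-3\<^esup>\<close>, which is Bernoulli's
inequality, and because the Beta(1,2) mixture of the inverse cube is exactly \<open>1 / (1 - k t / M)\<close>.

Since \<open>K\<close> is infinite beyond \<open>M\<close>, every feasible \<open>c\<close> is at least \<open>1 / M\<close>, and for those \<open>c\<close> feasibility of \<open>(v, c)\<close> means
\<open>V A(t) (1 - c t) \<le> v\<close> for \<open>0 < t < 1 / c\<close>. At \<open>v = V\<close> the two bounds give \<open>c = k / M\<close> as the smallest solution. For larger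
\<open>v\<close> and \<open>p > 3\<close> the scale can be lowered, because \<open>A\<close> is bounded on \<open>[0, M / k']\<close> for each \<open>k' > 1\<close>;
for the same reason every \<open>k' / M\<close> is feasible once \<open>v\<close> is large.

What remains is the formula for \<open>K\<close>, given that only the characteristic function of \<open>X\<close> is prescribed. It comes from
a zero-bias identity (\<open>zero_bias_eq_sum\<close>). Differentiating \<open>\<phi> = exp \<psi>\<close> shows that \<open>U X'\<close> has the law of
\<open>X + U Z\<close>, where \<open>X'\<close> has the square-biased law of \<open>X\<close>, \<open>U\<close> is uniform on \<open>[0, 1]\<close>, \<open>Z\<close> has law
\<open>x\<^sup>2 \<nu>(dx) / V\<close>, and factors in a product or sum are independent. Testing this equality of measures with \<open>t e\<^bsup>tw\<^esup>\<close> yields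
\<open>E X (e\<^bsup>tX\<^esup> - 1) = V t (E e\<^bsup>tX\<^esup>) (E e\<^bsup>tUZ\<^esup>)\<close> in \<open>[0, \<infinity>]\<close>, that is, \<open>m' = K' m\<close> for \<open>m(t) = E e\<^bsup>tX\<^esup>\<close>. Beyond \<open>M\<close>
the last factor is infinite, hence so is \<open>m\<close>. Below \<open>M\<close>, finiteness of \<open>m\<close> is not known beforehand; it follows from the
same argument for the truncated moments \<open>E exp (t min X N)\<close> and Gronwall's inequality, after which the differential equation
gives \<open>m = exp K\<close>.
\<close>

section \<open>Zero-bias measures\<close>

lemma has_vector_derivative_iff_quotient:
  fixes f :: "real \<Rightarrow> 'b :: real_normed_vector"
  shows "(f has_vector_derivative D) (at t within S) \<longleftrightarrow>
    ((\<lambda>s. (f s - f t) /\<^sub>R (s - t)) \<longlongrightarrow> D) (at t within S)"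
proof -
  have "norm (f s - f t - (s - t) *\<^sub>R D) / norm (s - t) = norm ((f s - f t) /\<^sub>R (s - t) - D)"
    if "s \<noteq> t" for s
  proof -
    have "norm ((f s - f t) /\<^sub>R (s - t) - D) = norm ((f s - f t - (s - t) *\<^sub>R D) /\<^sub>R (s - t))"
      using that by (simp add: scaleR_diff_right)
    then show ?thesis by (simp add: divide_inverse_commute)
  qed
  then have "((\<lambda>s. norm (f s - f t - (s - t) *\<^sub>R D) / norm (s - t)) \<longlongrightarrow> 0) (at t within S) \<longleftrightarrow>
      ((\<lambda>s. norm ((f s - f t) /\<^sub>R (s - t) - D)) \<longlongrightarrow> 0) (at t within S)"
    by (intro Lim_cong_within) auto
  then have "(f has_vector_derivative D) (at t within S) \<longleftrightarrow>
      ((\<lambda>s. norm ((f s - f t) /\<^sub>R (s - t) - D)) \<longlongrightarrow> 0) (at t within S)"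
    unfolding has_vector_derivative_def has_derivative_iff_norm
    by (simp add: bounded_linear_scaleR_left)
  then show ?thesis by (simp add: tendsto_norm_zero_iff LIM_zero_iff)
qed

text \<open>Dominated convergence needs a bound on the difference quotients of \<open>F\<close>; the mean value inequality
on the convex set \<open>S\<close> turns the bound on \<open>F'\<close> into one. One-sided derivatives at end points of
\<open>S\<close> are covered, which matters for moment generating functions, defined on \<open>[0, M)\<close> only.\<close>
lemma has_vector_derivative_integral:
  fixes F F' :: "real \<Rightarrow> 'a \<Rightarrow> 'b :: euclidean_space"
  assumes S: "convex S" "t \<in> S"
    and int: "\<And>s. s \<in> S \<Longrightarrow> integrable M (F s)"
    and deriv: "\<And>s x. s \<in> S \<Longrightarrow> ((\<lambda>s. F s x) has_vector_derivative F' s x) (at s within S)"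
    and bound: "\<And>s x. s \<in> S \<Longrightarrow> norm (F' s x) \<le> g x"
    and g: "integrable M g"
    and meas: "F' t \<in> borel_measurable M"
  shows "((\<lambda>s. integral\<^sup>L M (F s)) has_vector_derivative integral\<^sup>L M (F' t)) (at t within S)"
proof -
  have diff: "norm ((F s x - F t x) /\<^sub>R (s - t)) \<le> g x" if "s \<in> S" "s \<noteq> t" for s x
  proof -
    have "norm (F s x - F t x) \<le> g x * norm (s - t)"
    proof (rule differentiable_bound[OF S(1), where f = "\<lambda>s. F s x" and f' = "\<lambda>s h. h *\<^sub>R F' s x"])
      show "((\<lambda>s. F s x) has_derivative (\<lambda>h. h *\<^sub>R F' r x)) (at r within S)" if "r \<in> S" for r
        using deriv[OF that] by (simp add: has_vector_derivative_def)
      show "onorm (\<lambda>h. h *\<^sub>R F' r x) \<le> g x" if "r \<in> S" for r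
        by (rule onorm_le) (use mult_left_mono[OF bound[OF that], of "\<bar>h\<bar>" for h] in \<open>auto simp: mult.commute\<close>)
    qed (use that S in auto)
    then have "norm (F s x - F t x) / \<bar>s - t\<bar> \<le> g x"
      using that by (simp add: pos_divide_le_eq)
    then show ?thesis by (simp add: divide_inverse_commute)
  qed
  have "((\<lambda>s. (integral\<^sup>L M (F s) - integral\<^sup>L M (F t)) /\<^sub>R (s - t)) \<longlongrightarrow> integral\<^sup>L M (F' t)) (at t within S)"
    unfolding tendsto_at_iff_sequentially comp_def
  proof (intro allI impI)
    fix X assume X: "\<forall>i. X i \<in> S - {t}" "X \<longlonglongrightarrow> t"
    have "(\<lambda>i. \<integral>x. (F (X i) x - F t x) /\<^sub>R (X i - t) \<partial>M) \<longlonglongrightarrow> integral\<^sup>L M (F' t)"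
    proof (rule integral_dominated_convergence[where w = g])
      show "AE x in M. (\<lambda>i. (F (X i) x - F t x) /\<^sub>R (X i - t)) \<longlonglongrightarrow> F' t x"
      proof (rule AE_I2)
        fix x
        have "((\<lambda>s. (F s x - F t x) /\<^sub>R (s - t)) \<longlongrightarrow> F' t x) (at t within S)"
          using deriv[OF S(2), of x] by (simp add: has_vector_derivative_iff_quotient)
        then show "(\<lambda>i. (F (X i) x - F t x) /\<^sub>R (X i - t)) \<longlonglongrightarrow> F' t x"
          using X unfolding tendsto_at_iff_sequentially comp_def by blast
      qed
      show "AE x in M. norm ((F (X i) x - F t x) /\<^sub>R (X i - t)) \<le> g x" for i
        using diff X by auto
      show "(\<lambda>x. (F (X i) x - F t x) /\<^sub>R (X i - t)) \<in> borel_measurable M" for i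
        using int[of "X i"] int[OF S(2)] X by auto
    qed (use meas g in auto)
    moreover have "(\<integral>x. (F (X i) x - F t x) /\<^sub>R (X i - t) \<partial>M)
        = (integral\<^sup>L M (F (X i)) - integral\<^sup>L M (F t)) /\<^sub>R (X i - t)" for i
      using int[of "X i"] int[OF S(2)] X by simp
    ultimately show "(\<lambda>i. (integral\<^sup>L M (F (X i)) - integral\<^sup>L M (F t)) /\<^sub>R (X i - t)) \<longlonglongrightarrow> integral\<^sup>L M (F' t)"
      by (simp only:)
  qed
  then show ?thesis
    by (simp add: has_vector_derivative_iff_quotient)
qed

definition unit_uniform :: "real measure" where
  "unit_uniform = density lborel (indicator {0..1})"

lemma sets_unit_uniform [measurable_cong, simp]: "sets unit_uniform = sets borel"
  by (simp add: unit_uniform_def)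

lemma prob_space_unit_uniform: "prob_space unit_uniform"
  by (rule prob_spaceI) (simp add: unit_uniform_def emeasure_density)

lemma nn_integral_unit_uniform:
  "g \<in> borel_measurable borel \<Longrightarrow>
     (\<integral>\<^sup>+ b. g b \<partial>unit_uniform) = (\<integral>\<^sup>+ b. g b * indicator {0..1} b \<partial>lborel)"
  by (simp add: unit_uniform_def nn_integral_density mult.commute)

definition square_bias :: "real measure \<Rightarrow> real measure" where
  "square_bias \<sigma> = density \<sigma> (\<lambda>x. ennreal (x\<^sup>2 / (\<integral>x. x\<^sup>2 \<partial>\<sigma>)))"

text \<open>For the law of a centered variable \<open>X\<close> this is the zero-bias law of Goldstein and Reinert, written
through its representation \<open>B * X'\<close> with \<open>X'\<close> the square-biased variable and \<open>B\<close> uniform. The same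
formula makes sense for a Levy measure of finite second moment, where it gives the law of the
jump part in \<open>zero_bias_eq_sum\<close>.\<close>
definition zero_bias :: "real measure \<Rightarrow> real measure" where
  "zero_bias \<sigma> = distr (square_bias \<sigma> \<Otimes>\<^sub>M unit_uniform) borel (\<lambda>(z, b). b * z)"

locale positive_second_moment =
  fixes \<sigma> :: "real measure"
  assumes sets_eq [measurable_cong, simp]: "sets \<sigma> = sets borel"
    and integrable_square: "integrable \<sigma> (\<lambda>x. x\<^sup>2)"
    and second_moment_pos: "(\<integral>x. x\<^sup>2 \<partial>\<sigma>) > 0"
begin

abbreviation "second_moment \<equiv> (\<integral>x. x\<^sup>2 \<partial>\<sigma>)"

lemma sets_square_bias [measurable_cong, simp]: "sets (square_bias \<sigma>) = sets borel"
  by (simp add: square_bias_def)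

lemma prob_space_square_bias: "prob_space (square_bias \<sigma>)"
proof (rule prob_spaceI)
  have "emeasure (square_bias \<sigma>) (space (square_bias \<sigma>)) = (\<integral>\<^sup>+ x. ennreal (x\<^sup>2 / second_moment) \<partial>\<sigma>)"
    using sets.top[of \<sigma>] unfolding square_bias_def by (subst emeasure_density) (auto intro!: nn_integral_cong split: split_indicator)
  also have "\<dots> = ennreal (\<integral>x. x\<^sup>2 / second_moment \<partial>\<sigma>)"
    using integrable_square second_moment_pos by (intro nn_integral_eq_integral) auto
  also have "\<dots> = 1" using second_moment_pos by simp
  finally show "emeasure (square_bias \<sigma>) (space (square_bias \<sigma>)) = 1" .
qed

lemma pair_prob: "pair_prob_space (square_bias \<sigma>) unit_uniform"
  by (simp add: pair_prob_space_def pair_sigma_finite_def prob_space_square_bias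
      prob_space_unit_uniform prob_space_imp_sigma_finite)

lemma sets_zero_bias [measurable_cong, simp]: "sets (zero_bias \<sigma>) = sets borel"
  by (simp add: zero_bias_def)

lemma real_distribution_zero_bias: "real_distribution (zero_bias \<sigma>)"
proof -
  interpret pair_prob_space "square_bias \<sigma>" unit_uniform by (rule pair_prob)
  show ?thesis unfolding zero_bias_def by (rule real_distribution_distr) simp
qed

lemma nn_integral_zero_bias:
  assumes [measurable]: "g \<in> borel_measurable borel"
  shows "(\<integral>\<^sup>+ w. g w \<partial>zero_bias \<sigma>) =
    (\<integral>\<^sup>+ z. ennreal (z\<^sup>2 / second_moment) * (\<integral>\<^sup>+ b. g (b * z) \<partial>unit_uniform) \<partial>\<sigma>)"
proof -
  interpret pair_prob_space "square_bias \<sigma>" unit_uniform by (rule pair_prob)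
  have "(\<integral>\<^sup>+ w. g w \<partial>zero_bias \<sigma>) = (\<integral>\<^sup>+ z. \<integral>\<^sup>+ b. g (b * z) \<partial>unit_uniform \<partial>square_bias \<sigma>)"
    unfolding zero_bias_def
    by (subst nn_integral_distr, simp, simp) (subst M2.nn_integral_fst[symmetric], auto simp: split_beta)
  also have "\<dots> = (\<integral>\<^sup>+ z. ennreal (z\<^sup>2 / second_moment) * (\<integral>\<^sup>+ b. g (b * z) \<partial>unit_uniform) \<partial>\<sigma>)"
    unfolding square_bias_def by (subst nn_integral_density) auto
  finally show ?thesis .
qed

lemma integral_iexp_unit_uniform:
  "\<i> * u * z * (\<integral>b. iexp (u * (b * z)) \<partial>unit_uniform) = iexp (u * z) - 1"
proof (cases "u * z = 0")
  case False
  have "(\<integral>b. iexp (u * (b * z)) \<partial>unit_uniform) = (\<integral>b. indicator {0..1} b *\<^sub>R iexp (u * (b * z)) \<partial>lborel)"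
  proof -
    have "unit_uniform = density lborel (\<lambda>x. ennreal (indicator {0..1} x))"
      by (simp add: unit_uniform_def ennreal_indicator)
    then show ?thesis by (subst integral_density[symmetric]) auto
  qed
  also have "\<dots> = iexp (u * z) / (\<i> * (u * z)) - 1 / (\<i> * (u * z))"
  proof (subst integral_FTC_Icc[where F = "\<lambda>b. iexp (u * (b * z)) / (\<i> * (u * z))"])
    show "((\<lambda>b. iexp (u * (b * z)) / (\<i> * (u * z))) has_vector_derivative iexp (u * (b * z)))
        (at b within {0..1})" for b
    proof -
      have "((\<lambda>w. exp (\<i> * (u * (w * z))) / (\<i> * (u * z))) has_field_derivative iexp (u * (b * z)))
          (at (complex_of_real b))"
        using False by (auto intro!: derivative_eq_intros simp: field_simps)
      from has_vector_derivative_real_field[OF this] show ?thesis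
        by (simp add: o_def)
    qed
  qed (auto intro!: continuous_intros)
  finally show ?thesis using False by (simp add: field_simps)
qed auto

text \<open>Integrating \<open>x\<^sup>2 e\<^bsup>iubx\<^esup>\<close> over \<open>b\<close> in the unit interval gives \<open>x (e\<^bsup>iux\<^esup> - 1) / (iu)\<close>. The right-hand
side is linear in \<open>\<sigma>\<close>, so it applies equally to a law and to an infinite Levy measure, and in both cases it
is a logarithmic or ordinary derivative of a characteristic function.\<close>
lemma char_zero_bias:
  "second_moment * (\<i> * u * char (zero_bias \<sigma>) u) = (\<integral>x. x * (iexp (u * x) - 1) \<partial>\<sigma>)"
proof -
  interpret pair_prob_space "square_bias \<sigma>" unit_uniform by (rule pair_prob)
  have int: "integrable (square_bias \<sigma> \<Otimes>\<^sub>M unit_uniform) (\<lambda>(z, b). iexp (u * (b * z)))"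
    by (rule integrable_const_bound[where B = 1]) (auto simp: norm_exp_i_times)
  have "char (zero_bias \<sigma>) u = (\<integral>z. \<integral>b. iexp (u * (b * z)) \<partial>unit_uniform \<partial>square_bias \<sigma>)"
    unfolding zero_bias_def char_def
    by (subst integral_distr) (use integral_fst'[OF int] in \<open>auto simp: case_prod_unfold\<close>)
  also have "\<dots> = (\<integral>z. (z\<^sup>2 / second_moment) *\<^sub>R (\<integral>b. iexp (u * (b * z)) \<partial>unit_uniform) \<partial>\<sigma>)"
    unfolding square_bias_def using second_moment_pos by (subst integral_density) auto
  finally have "second_moment * (\<i> * u * char (zero_bias \<sigma>) u)
      = (\<integral>z. second_moment * (\<i> * u * ((z\<^sup>2 / second_moment) *\<^sub>R (\<integral>b. iexp (u * (b * z)) \<partial>unit_uniform))) \<partial>\<sigma>)"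
    by (simp only: integral_mult_right_zero)
  also have "\<dots> = (\<integral>x. x * (iexp (u * x) - 1) \<partial>\<sigma>)"
  proof (rule Bochner_Integration.integral_cong[OF refl])
    fix z
    have "second_moment * (\<i> * u * ((z\<^sup>2 / second_moment) *\<^sub>R (\<integral>b. iexp (u * (b * z)) \<partial>unit_uniform)))
      = z * (\<i> * u * z * (\<integral>b. iexp (u * (b * z)) \<partial>unit_uniform))"
      using second_moment_pos by (simp add: scaleR_conv_of_real power2_eq_square)
    then show "second_moment * (\<i> * u * ((z\<^sup>2 / second_moment) *\<^sub>R (\<integral>b. iexp (u * (b * z)) \<partial>unit_uniform)))
        = z * (iexp (u * z) - 1)"
      unfolding integral_iexp_unit_uniform .
  qed
  finally show ?thesis .
qed

end

section \<open>The zero-bias identity for infinitely divisible laws\<close>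

lemma norm_iexp_diff_one_le: "norm (iexp y - 1) \<le> \<bar>y\<bar>"
  using iexp_approx1[of y 0] by simp

lemma norm_iexp_second_order_le: "norm (iexp y - 1 - \<i> * y) \<le> y\<^sup>2 / 2"
  using iexp_approx1[of y 1] by (simp add: power2_eq_square diff_diff_eq)

lemma has_vector_derivative_char:
  assumes "real_distribution \<mu>" and int: "integrable \<mu> (\<lambda>x. x)"
  shows "(char \<mu> has_vector_derivative (\<integral>x. \<i> * x * iexp (u * x) \<partial>\<mu>)) (at u)"
proof -
  interpret real_distribution \<mu> by fact
  have "((\<lambda>s. integral\<^sup>L \<mu> (\<lambda>x. iexp (s * x))) has_vector_derivative
      integral\<^sup>L \<mu> (\<lambda>x. \<i> * x * iexp (u * x))) (at u within UNIV)"
  proof (rule has_vector_derivative_integral[where F = "\<lambda>s x. iexp (s * x)" and F' = "\<lambda>s x. \<i> * x * iexp (s * x)"])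
    show "((\<lambda>s. iexp (s * x)) has_vector_derivative \<i> * x * iexp (s * x)) (at s within UNIV)" for s x
    proof -
      have "((\<lambda>w. exp (\<i> * (w * x))) has_field_derivative \<i> * x * iexp (s * x)) (at (complex_of_real s))"
        by (auto intro!: derivative_eq_intros simp: field_simps)
      from has_vector_derivative_real_field[OF this] show ?thesis by (simp add: o_def)
    qed
    show "norm (\<i> * x * iexp (s * x)) \<le> \<bar>x\<bar>" for s x :: real
      by (simp add: norm_mult)
    show "complex_integrable \<mu> (\<lambda>x. iexp (s * x))" for s
      by (rule integrable_const_bound[where B = 1]) auto
  qed (use int in auto)
  then show ?thesis by (simp add: char_def[abs_def])
qed

lemma has_vector_derivative_compensated_exponent:
  fixes \<nu> :: "real measure"
  assumes sets [measurable_cong]: "sets \<nu> = sets borel" and sq: "integrable \<nu> (\<lambda>x. x\<^sup>2)"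
  shows "((\<lambda>u. \<integral>x. iexp (u * x) - 1 - \<i> * complex_of_real (u * x) \<partial>\<nu>) has_vector_derivative
    (\<integral>x. \<i> * x * (iexp (u * x) - 1) \<partial>\<nu>)) (at u)"
proof -
  let ?S = "{- \<bar>u\<bar> - 1 .. \<bar>u\<bar> + 1}"
  have "((\<lambda>s. integral\<^sup>L \<nu> (\<lambda>x. iexp (s * x) - 1 - \<i> * complex_of_real (s * x))) has_vector_derivative
      integral\<^sup>L \<nu> (\<lambda>x. \<i> * x * (iexp (u * x) - 1))) (at u within ?S)"
  proof (rule has_vector_derivative_integral[where F = "\<lambda>s x. iexp (s * x) - 1 - \<i> * complex_of_real (s * x)"
        and F' = "\<lambda>s x. \<i> * x * (iexp (s * x) - 1)" and g = "\<lambda>x. (\<bar>u\<bar> + 1) * x\<^sup>2"])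
    show "((\<lambda>s. iexp (s * x) - 1 - \<i> * complex_of_real (s * x)) has_vector_derivative
        \<i> * x * (iexp (s * x) - 1)) (at s within ?S)" for s x
    proof -
      have "((\<lambda>w. exp (\<i> * (w * x)) - 1 - \<i> * (w * x)) has_field_derivative \<i> * x * (iexp (s * x) - 1))
          (at (complex_of_real s))"
        by (auto intro!: derivative_eq_intros simp: field_simps)
      from has_vector_derivative_real_field[OF this] show ?thesis
        by (simp add: o_def)
    qed
    show "norm (\<i> * x * (iexp (s * x) - 1)) \<le> (\<bar>u\<bar> + 1) * x\<^sup>2" if "s \<in> ?S" for s x :: real
    proof -
      have "norm (\<i> * x * (iexp (s * x) - 1)) \<le> \<bar>x\<bar> * \<bar>s * x\<bar>"
        unfolding norm_mult by (intro mult_mono norm_iexp_diff_one_le) auto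
      also have "\<dots> = \<bar>s\<bar> * x\<^sup>2" by (simp add: abs_mult power2_eq_square)
      also have "\<dots> \<le> (\<bar>u\<bar> + 1) * x\<^sup>2" using that by (intro mult_right_mono) auto
      finally show ?thesis .
    qed
    show "complex_integrable \<nu> (\<lambda>x. iexp (s * x) - 1 - \<i> * complex_of_real (s * x))" for s
      using integrable_mult_right[OF sq, of "s\<^sup>2 / 2"]
    proof (rule Bochner_Integration.integrable_bound)
      show "AE x in \<nu>. norm (iexp (s * x) - 1 - \<i> * complex_of_real (s * x)) \<le> norm (s\<^sup>2 / 2 * x\<^sup>2)"
        using norm_iexp_second_order_le[of "s * _"] by (intro AE_I2) (simp add: power_mult_distrib)
    qed measurable
  qed (use sq in auto)
  moreover have "u \<in> interior ?S" by auto
  then have "at u within ?S = at u" by (rule at_within_interior)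
  ultimately show ?thesis by (simp only:)
qed

text \<open>The second assumption excludes the zero measure, for which the square-biased measure would not be
a probability measure.\<close>
locale centered_inf_div =
  fixes P :: "'a measure" and X :: "'a \<Rightarrow> real" and \<nu> :: "real measure"
  assumes inf_div: "centered_inf_div_rv P X 0 \<nu>"
    and levy_second_moment_pos: "(\<integral>x. x\<^sup>2 \<partial>\<nu>) > 0"
begin

abbreviation "\<mu> \<equiv> distr P borel X"
abbreviation "V \<equiv> prob_space.variance P X"

sublocale P: prob_space P
  using inf_div by (simp add: centered_inf_div_rv_def)

lemma measurable_X [measurable]: "X \<in> borel_measurable P"
  and integrable_X: "integrable P X"
  and integrable_X_square: "integrable P (\<lambda>\<omega>. (X \<omega>)\<^sup>2)"
  and mean_zero: "P.expectation X = 0"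
  and variance_pos: "V > 0"
  and sets_levy [measurable_cong, simp]: "sets \<nu> = sets borel"
  using inf_div by (auto simp: centered_inf_div_rv_def finite_variance_levy_measure_def)

sublocale \<mu>: real_distribution \<mu>
  by (rule P.real_distribution_distr) simp

lemma second_moment_distr: "(\<integral>x. x\<^sup>2 \<partial>\<mu>) = V"
  by (simp add: integral_distr mean_zero)

sublocale law: positive_second_moment \<mu>
  by unfold_locales (use variance_pos integrable_X_square in \<open>auto simp: second_moment_distr integrable_distr_eq mean_zero\<close>)

sublocale levy: positive_second_moment \<nu>
proof unfold_locales
  have "(\<integral>\<^sup>+ x. ennreal (x\<^sup>2) \<partial>\<nu>) < \<infinity>"
    using inf_div by (auto simp: centered_inf_div_rv_def finite_variance_levy_measure_def)
  then show "integrable \<nu> (\<lambda>x. x\<^sup>2)"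
    by (intro integrableI_nonneg) auto
qed (use levy_second_moment_pos in auto)

sublocale zb_law: real_distribution "zero_bias \<mu>" by (rule law.real_distribution_zero_bias)
sublocale zb_levy: real_distribution "zero_bias \<nu>" by (rule levy.real_distribution_zero_bias)

text \<open>With \<open>\<phi> = exp \<psi>\<close> the characteristic function of \<open>X\<close>, this is \<open>\<phi>' = \<psi>' \<phi>\<close>. By \<open>char_zero_bias\<close>, \<open>\<phi>'\<close> is
\<open>- u\<close> times the left-hand side, as \<open>X\<close> has mean zero, and \<open>\<psi>'\<close> is \<open>- u\<close> times the second moment of \<open>\<nu>\<close> times
\<open>char (zero_bias \<nu>) u\<close>.\<close>
lemma char_zero_bias_factor:
  assumes "u \<noteq> 0"
  shows "V * char (zero_bias \<mu>) u = (\<integral>x. x\<^sup>2 \<partial>\<nu>) * (char \<mu> u * char (zero_bias \<nu>) u)"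
proof -
  define \<psi> where "\<psi> = (\<lambda>u. \<integral>x. iexp (u * x) - 1 - \<i> * complex_of_real (u * x) \<partial>\<nu>)"
  define D where "D = (\<integral>x. \<i> * x * (iexp (u * x) - 1) \<partial>\<nu>)"
  have char_eq: "char \<mu> = exp \<circ> \<psi>"
    using inf_div by (auto simp: centered_inf_div_rv_def \<psi>_def fun_eq_iff)
  have int: "integrable \<mu> (\<lambda>x. x)" by (simp add: integrable_distr_eq integrable_X)
  have "(\<psi> has_vector_derivative D) (at u)"
    unfolding \<psi>_def D_def by (rule has_vector_derivative_compensated_exponent[OF sets_levy levy.integrable_square])
  then have "(char \<mu> has_vector_derivative D * exp (\<psi> u)) (at u)"
    unfolding char_eq by (rule field_vector_diff_chain_at) (rule DERIV_exp)
  with has_vector_derivative_char[OF \<mu>.real_distribution_axioms int, of u]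
  have eq: "(\<integral>x. \<i> * x * iexp (u * x) \<partial>\<mu>) = D * char \<mu> u"
    by (auto dest: vector_derivative_unique_at simp: char_eq)
  have "complex_integrable \<mu> (\<lambda>x. x * iexp (u * x))"
    by (rule Bochner_Integration.integrable_bound[OF int]) (auto simp: norm_mult)
  then have "(\<integral>x. x * (iexp (u * x) - 1) \<partial>\<mu>) = (\<integral>x. x * iexp (u * x) \<partial>\<mu>) - complex_of_real (\<integral>x. x \<partial>\<mu>)"
    using int by (simp add: right_diff_distrib)
  also have "(\<integral>x. x \<partial>\<mu>) = 0" by (simp add: integral_distr mean_zero)
  finally have "\<i> * (\<integral>x. x * (iexp (u * x) - 1) \<partial>\<mu>) = D * char \<mu> u"
    using eq by (simp add: mult.assoc)
  moreover have "D = \<i> * (\<integral>x. x * (iexp (u * x) - 1) \<partial>\<nu>)"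
    by (simp add: D_def mult.assoc)
  ultimately have "\<i> * (\<integral>x. x * (iexp (u * x) - 1) \<partial>\<mu>) = \<i> * ((\<integral>x. x * (iexp (u * x) - 1) \<partial>\<nu>) * char \<mu> u)"
    by (simp only: mult.assoc)
  then have "(\<integral>x. x * (iexp (u * x) - 1) \<partial>\<mu>) = (\<integral>x. x * (iexp (u * x) - 1) \<partial>\<nu>) * char \<mu> u"
    by (simp only: mult_cancel_left) simp
  then have "\<i> * u * (V * char (zero_bias \<mu>) u) =
      \<i> * u * ((\<integral>x. x\<^sup>2 \<partial>\<nu>) * (char \<mu> u * char (zero_bias \<nu>) u))"
    unfolding law.char_zero_bias[symmetric] levy.char_zero_bias[symmetric] second_moment_distr
    by (simp only: ac_simps)
  then show ?thesis using assms by (simp only: mult_cancel_left) simp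
qed

text \<open>Both sides of the preceding identity are continuous in \<open>u\<close>, so it extends to \<open>u = 0\<close>, where all three
characteristic functions equal 1.\<close>
lemma variance_eq_levy_second_moment: "V = (\<integral>x. x\<^sup>2 \<partial>\<nu>)"
proof -
  let ?f = "\<lambda>u. complex_of_real V * char (zero_bias \<mu>) u"
  let ?g = "\<lambda>u. complex_of_real (\<integral>x. x\<^sup>2 \<partial>\<nu>) * (char \<mu> u * char (zero_bias \<nu>) u)"
  have f: "(?f \<longlongrightarrow> ?f 0) (at 0)"
    by (intro tendsto_mult tendsto_const zb_law.isCont_char[of 0, unfolded isCont_def])
  have g: "(?g \<longlongrightarrow> ?g 0) (at 0)"
    by (intro tendsto_mult tendsto_const zb_levy.isCont_char[of 0, unfolded isCont_def] \<mu>.isCont_char[of 0, unfolded isCont_def])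
  have "\<forall>\<^sub>F u in at 0. ?f u = ?g u"
    unfolding eventually_at_filter by (intro always_eventually allI impI char_zero_bias_factor)
  with f have "(?g \<longlongrightarrow> ?f 0) (at 0)" by (rule Lim_transform_eventually)
  from tendsto_unique[OF at_neq_bot this g] have "?f 0 = ?g 0" .
  then have "complex_of_real V = complex_of_real (\<integral>x. x\<^sup>2 \<partial>\<nu>)"
    unfolding zb_law.char_zero zb_levy.char_zero \<mu>.char_zero by (simp only: mult_1_right)
  then show ?thesis by (simp only: of_real_eq_iff)
qed

text \<open>This is the form in which the Levy-Khintchine formula is used from here on: it is an identity between
probability measures, so it can be integrated against arbitrary nonnegative functions, in particular
against exponentials that may fail to be integrable. It thus does the work of an analytic continuation of the characteristic
function to real exponents.\<close>
theorem zero_bias_eq_sum: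
  "zero_bias \<mu> = distr (\<mu> \<Otimes>\<^sub>M zero_bias \<nu>) borel (\<lambda>(x, y). x + y)"
proof -
  interpret pair: pair_prob_space \<mu> "zero_bias \<nu>"
    by (intro pair_prob_space.intro pair_sigma_finite.intro prob_space_imp_sigma_finite
        \<mu>.prob_space_axioms zb_levy.prob_space_axioms)
  have [measurable_cong]: "sets (zero_bias \<nu>) = sets borel" by simp
  let ?S = "distr (\<mu> \<Otimes>\<^sub>M zero_bias \<nu>) borel (\<lambda>(x, y). x + y)"
  interpret S: real_distribution ?S
    by (rule pair.real_distribution_distr) measurable
  have sum: "char ?S u = char \<mu> u * char (zero_bias \<nu>) u" for u
  proof -
    have int: "complex_integrable (\<mu> \<Otimes>\<^sub>M zero_bias \<nu>) (\<lambda>(x, y). iexp (u * (x + y)))"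
      by (rule pair.P.integrable_const_bound[where B = 1]) (auto simp: split_beta)
    have "char ?S u = (\<integral>x. \<integral>y. iexp (u * (x + y)) \<partial>zero_bias \<nu> \<partial>\<mu>)"
      unfolding char_def
      by (subst integral_distr) (use pair.integral_fst'[OF int] in \<open>auto simp: case_prod_unfold\<close>)
    also have "\<dots> = char \<mu> u * char (zero_bias \<nu>) u"
      by (simp add: char_def ring_distribs exp_add)
    finally show ?thesis .
  qed
  show ?thesis
  proof (rule Levy_uniqueness)
    show "char (zero_bias \<mu>) = char ?S"
    proof
      fix u show "char (zero_bias \<mu>) u = char ?S u"
      proof (cases "u = 0")
        case True
        then show ?thesis using zb_law.char_zero S.char_zero by simp
      next
        case False
        with char_zero_bias_factor[of u] variance_pos show ?thesis
          unfolding sum variance_eq_levy_second_moment[symmetric] by simp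
      qed
    qed
  qed (rule zb_law.real_distribution_axioms S.real_distribution_axioms)+
qed

end

section \<open>Mixtures of gamma generating functions\<close>

text \<open>The moment generating function, on \<open>s < M\<close>, of the gamma law with shape \<open>p\<close> and rate \<open>M\<close>. It is the
second derivative of the cumulant generating function divided by the variance; integrating it twice gives
the two functions that follow.\<close>
definition gamma_mgf :: "real \<Rightarrow> real \<Rightarrow> real \<Rightarrow> real" where
  "gamma_mgf M p s = (1 - s / M) powr (- p)"

definition unit_cgf_deriv :: "real \<Rightarrow> real \<Rightarrow> real \<Rightarrow> real" where
  "unit_cgf_deriv M p t = integral {0..t} (gamma_mgf M p)"

definition unit_cgf :: "real \<Rightarrow> real \<Rightarrow> real \<Rightarrow> real" where
  "unit_cgf M p t = integral {0..t} (unit_cgf_deriv M p)"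

text \<open>The cumulant generating function relative to the Gaussian one of the same variance. Sub-gamma bounds with
variance factor \<open>V\<close> are upper bounds \<open>1 / (1 - c t)\<close> for this ratio.\<close>
definition cgf_ratio :: "real \<Rightarrow> real \<Rightarrow> real \<Rightarrow> real" where
  "cgf_ratio M p t = 2 * unit_cgf M p t / t\<^sup>2"

text \<open>Bernoulli's inequality \<open>1 - k x \<le> (1 - x)\<^sup>k\<close> for real exponents \<open>k \<ge> 1\<close>, in logarithmic form.\<close>
lemma neg_ln_one_minus_le:
  fixes k x :: real
  assumes "1 \<le> k" "0 \<le> x" "k * x < 1"
  shows "- (k * ln (1 - x)) \<le> - ln (1 - k * x)"
proof -
  let ?f = "\<lambda>y. k * ln (1 - y) - ln (1 - k * y)"
  have "?f 0 \<le> ?f x"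
  proof (rule DERIV_nonneg_imp_nondecreasing[OF assms(2)])
    fix y assume y: "0 \<le> y" "y \<le> x"
    have "k * y \<le> k * x" using y assms by (intro mult_left_mono) auto
    then have ky: "k * y < 1" using assms by linarith
    have "1 * y \<le> k * y" using y assms by (intro mult_right_mono) auto
    then have yk: "y \<le> k * y" by simp
    have "(?f has_real_derivative (k / (1 - k * y) - k / (1 - y))) (at y)"
      using ky yk by (auto intro!: derivative_eq_intros simp: field_simps)
    moreover have "k / (1 - y) \<le> k / (1 - k * y)"
      using ky yk assms by (intro divide_left_mono) auto
    ultimately show "\<exists>D. (?f has_real_derivative D) (at y) \<and> 0 \<le> D"
      by auto
  qed
  then show ?thesis by simp
qed

lemma one_plus_le_powr:
  fixes x p :: real
  assumes "0 \<le> p" "x < 1"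
  shows "1 + p * x \<le> (1 - x) powr (- p)"
proof -
  have "ln (1 - x) \<le> - x" using ln_le_minus_one[of "1 - x"] assms by simp
  then have "p * ln (1 - x) \<le> p * (- x)" using assms by (intro mult_left_mono)
  then have "1 + p * x \<le> 1 + (- p * ln (1 - x))" by simp
  also have "\<dots> \<le> exp (- p * ln (1 - x))" by (rule exp_ge_add_one_self)
  also have "\<dots> = (1 - x) powr (- p)" using assms by (simp add: powr_def)
  finally show ?thesis .
qed

text \<open>The exponent 3 is the one for which the mixture over the Beta(1,2) law is \<open>1 / (1 - k x)\<close>; see
\<open>beta_mixture_cauchy_cube\<close>. Comparing with it is what makes \<open>p / 3\<close> the critical scale.\<close>
lemma powr_le_inverse_cube:
  fixes x p k :: real
  assumes "0 \<le> p" "1 \<le> k" "p \<le> 3 * k" "0 \<le> x" "k * x < 1"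
  shows "(1 - x) powr (- p) \<le> 1 / (1 - k * x) ^ 3"
proof -
  have "1 * x \<le> k * x" using assms by (intro mult_right_mono) auto
  then have x: "x < 1" using assms by simp
  then have "p * (- ln (1 - x)) \<le> 3 * k * (- ln (1 - x))"
    using assms by (intro mult_right_mono) auto
  also have "\<dots> \<le> 3 * (- ln (1 - k * x))"
    using neg_ln_one_minus_le[of k x] assms by simp
  finally have "(1 - x) powr (- p) \<le> (1 - k * x) powr (- 3)"
    using x assms by (simp add: powr_def)
  also have "\<dots> = 1 / (1 - k * x) ^ 3"
    using assms by (simp add: powr_minus_divide)
  finally show ?thesis .
qed

text \<open>An antiderivative exists because the derivative of \<open>(1 - b) / (1 - r b)\<close> is \<open>- (1 - r) / (1 - r b)\<^sup>2\<close>.\<close>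
lemma beta_mixture_cauchy_cube:
  fixes r :: real
  assumes "r < 1"
  shows "((\<lambda>b. 2 * (1 - b) / (1 - r * b) ^ 3) has_integral 1 / (1 - r)) {0..1}"
proof -
  let ?F = "\<lambda>b. - ((1 - b) / (1 - r * b))\<^sup>2 / (1 - r)"
  have "((\<lambda>b. 2 * (1 - b) / (1 - r * b) ^ 3) has_integral ?F 1 - ?F 0) {0..1}"
  proof (rule fundamental_theorem_of_calculus)
    fix b :: real assume b: "b \<in> {0..1}"
    have "r * b < 1"
    proof (cases "r \<le> 0")
      case True
      then have "r * b \<le> 0" using b by (simp add: mult_le_0_iff)
      then show ?thesis by simp
    next
      case False
      then have "r * b \<le> r * 1" using b by (intro mult_left_mono) auto
      then show ?thesis using assms by simp
    qed
    have "1 - r * b \<noteq> 0" "1 - r \<noteq> 0" using \<open>r * b < 1\<close> assms by auto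
    define d where "d = 1 - r * b"
    have "((\<lambda>b. (1 - b) / (1 - r * b)) has_real_derivative (r - 1) / d\<^sup>2) (at b within {0..1})"
      using \<open>1 - r * b \<noteq> 0\<close> unfolding d_def
      by (auto intro!: derivative_eq_intros simp: power2_eq_square) (simp add: algebra_simps)
    from DERIV_power[OF this, of 2]
    have "((\<lambda>b. ((1 - b) / (1 - r * b))\<^sup>2) has_real_derivative 2 * ((1 - b) / d) * ((r - 1) / d\<^sup>2)) (at b within {0..1})"
      by (simp add: d_def algebra_simps)
    from DERIV_cdivide[OF DERIV_minus[OF this], of "1 - r"]
    have "(?F has_real_derivative - (2 * ((1 - b) / d) * ((r - 1) / d\<^sup>2)) / (1 - r)) (at b within {0..1})" .
    also have "- (2 * ((1 - b) / d) * ((r - 1) / d\<^sup>2)) / (1 - r) = 2 * (1 - b) / d ^ 3"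
      using \<open>1 - r \<noteq> 0\<close> \<open>1 - r * b \<noteq> 0\<close> unfolding d_def[symmetric]
      by (simp add: divide_simps power2_eq_square power3_eq_cube) (simp add: algebra_simps)
    finally show "(?F has_vector_derivative 2 * (1 - b) / (1 - r * b) ^ 3) (at b within {0..1})"
      by (simp add: has_real_derivative_iff_has_vector_derivative d_def)
  qed simp
  then show ?thesis by simp
qed

locale gamma_mixture =
  fixes M p :: real
  assumes M_pos: "M > 0" and p_pos: "p > 0"
begin

lemma continuous_gamma_mgf: "T < M \<Longrightarrow> continuous_on {0..T} (gamma_mgf M p)"
  unfolding gamma_mgf_def using M_pos by (intro continuous_intros) auto

lemma gamma_mgf_pos: "s < M \<Longrightarrow> gamma_mgf M p s > 0"
  using M_pos by (simp add: gamma_mgf_def)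

lemma gamma_mgf_mono: "s \<le> t \<Longrightarrow> t < M \<Longrightarrow> gamma_mgf M p s \<le> gamma_mgf M p t"
  unfolding gamma_mgf_def using M_pos p_pos
  by (intro powr_mono2') (auto simp: divide_right_mono)

lemma has_derivative_unit_cgf_deriv:
  "T < M \<Longrightarrow> t \<in> {0..T} \<Longrightarrow>
    (unit_cgf_deriv M p has_real_derivative gamma_mgf M p t) (at t within {0..T})"
  unfolding unit_cgf_deriv_def by (rule integral_has_real_derivative[OF continuous_gamma_mgf])

lemma has_derivative_unit_cgf:
  assumes "T < M" "t \<in> {0..T}"
  shows "(unit_cgf M p has_real_derivative unit_cgf_deriv M p t) (at t within {0..T})"
proof -
  have "continuous_on {0..T} (unit_cgf_deriv M p)"
    using has_derivative_unit_cgf_deriv[OF assms(1)] by (rule DERIV_continuous_on)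
  then show ?thesis
    unfolding unit_cgf_def using assms(2) by (rule integral_has_real_derivative)
qed

lemma unit_cgf_zero [simp]: "unit_cgf M p 0 = 0" "unit_cgf_deriv M p 0 = 0"
  by (simp_all add: unit_cgf_def unit_cgf_deriv_def)

lemma derivative_rescaled:
  assumes "0 < t" "t < M" "b \<in> {0..1}"
  shows "((\<lambda>b. unit_cgf_deriv M p (b * t)) has_real_derivative gamma_mgf M p (b * t) * t) (at b within {0..1})"
    and "((\<lambda>b. unit_cgf M p (b * t)) has_real_derivative unit_cgf_deriv M p (b * t) * t) (at b within {0..1})"
proof -
  have sub: "(\<lambda>b. b * t) ` {0..1} \<subseteq> {0..t}" using assms
    by (auto simp: mult_le_cancel_right1 intro!: mult_left_le_one_le)
  then have bt: "b * t \<in> {0..t}" using assms by blast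
  have lin: "((\<lambda>b. b * t) has_real_derivative t) (at b within {0..1})"
    by (auto intro!: derivative_eq_intros)
  show "((\<lambda>b. unit_cgf_deriv M p (b * t)) has_real_derivative gamma_mgf M p (b * t) * t) (at b within {0..1})"
    using DERIV_image_chain[OF DERIV_subset[OF has_derivative_unit_cgf_deriv[OF assms(2) bt] sub] lin]
    by (simp add: o_def)
  show "((\<lambda>b. unit_cgf M p (b * t)) has_real_derivative unit_cgf_deriv M p (b * t) * t) (at b within {0..1})"
    using DERIV_image_chain[OF DERIV_subset[OF has_derivative_unit_cgf[OF assms(2) bt] sub] lin]
    by (simp add: o_def)
qed

lemma scale_less:
  assumes "0 < t" "t < M" "b \<le> 1"
  shows "b * t < M"
proof -
  have "b * t \<le> 1 * t" using assms by (intro mult_right_mono) auto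
  then show ?thesis using assms by linarith
qed

lemma uniform_mixture:
  assumes "0 < t" "t < M"
  shows "((\<lambda>b. t * gamma_mgf M p (b * t)) has_integral unit_cgf_deriv M p t) {0..1}"
proof -
  have "((\<lambda>b. t * gamma_mgf M p (b * t)) has_integral
      unit_cgf_deriv M p (1 * t) - unit_cgf_deriv M p (0 * t)) {0..1}"
    using derivative_rescaled(1)[OF assms]
    by (intro fundamental_theorem_of_calculus)
      (auto simp: has_real_derivative_iff_has_vector_derivative mult.commute)
  then show ?thesis by simp
qed

text \<open>Taylor's formula with integral remainder: the Beta(1,2) weight \<open>2 (1 - b)\<close> undoes two integrations. The antiderivative
in the proof comes from integration by parts.\<close>
lemma beta_mixture:
  assumes "0 < t" "t < M"
  shows "((\<lambda>b. 2 * (1 - b) * gamma_mgf M p (b * t)) has_integral cgf_ratio M p t) {0..1}"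
proof -
  let ?F = "\<lambda>b. 2 * (1 - b) * unit_cgf_deriv M p (b * t) / t + 2 * unit_cgf M p (b * t) / t\<^sup>2"
  have "((\<lambda>b. 2 * (1 - b) * gamma_mgf M p (b * t)) has_integral ?F 1 - ?F 0) {0..1}"
  proof (rule fundamental_theorem_of_calculus)
    fix b :: real assume b: "b \<in> {0..1}"
    have "(?F has_real_derivative 2 * (1 - b) * gamma_mgf M p (b * t)) (at b within {0..1})"
      using assms(1)
      by (auto intro!: derivative_eq_intros derivative_rescaled[OF assms b] simp: field_simps power2_eq_square)
    then show "(?F has_vector_derivative 2 * (1 - b) * gamma_mgf M p (b * t)) (at b within {0..1})"
      by (simp add: has_real_derivative_iff_has_vector_derivative)
  qed simp
  then show ?thesis by (simp add: cgf_ratio_def)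
qed

lemma cgf_ratio_mono:
  assumes "0 < s" "s \<le> t" "t < M"
  shows "cgf_ratio M p s \<le> cgf_ratio M p t"
proof (rule has_integral_le)
  show "((\<lambda>b. 2 * (1 - b) * gamma_mgf M p (b * s)) has_integral cgf_ratio M p s) {0..1}"
    "((\<lambda>b. 2 * (1 - b) * gamma_mgf M p (b * t)) has_integral cgf_ratio M p t) {0..1}"
    using assms by (simp_all only: beta_mixture)
  fix b :: real assume "b \<in> {0..1}"
  moreover from this assms have "b * t \<le> 1 * t" by (intro mult_right_mono) auto
  then have "b * t < M" using assms by linarith
  ultimately show "2 * (1 - b) * gamma_mgf M p (b * s) \<le> 2 * (1 - b) * gamma_mgf M p (b * t)"
    using assms by (intro mult_left_mono gamma_mgf_mono) auto
qed

text \<open>To first order in \<open>t\<close> this is an equality, which makes \<open>p / (3 M)\<close> a lower bound for every admissible scale at the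
variance.\<close>
lemma cgf_ratio_lower:
  assumes "0 < t" "t < M"
  shows "1 + p / 3 * (t / M) \<le> cgf_ratio M p t"
proof (rule has_integral_le)
  let ?F = "\<lambda>b. 2 * b - b\<^sup>2 + p * (t / M) * (b\<^sup>2 - 2 * b ^ 3 / 3)"
  have "((\<lambda>b. 2 * (1 - b) * (1 + p * (b * t / M))) has_integral ?F 1 - ?F 0) {0..1}"
    by (rule fundamental_theorem_of_calculus)
      (use M_pos in \<open>auto intro!: derivative_eq_intros simp: has_real_derivative_iff_has_vector_derivative[symmetric]
        algebra_simps power2_eq_square\<close>)
  then show "((\<lambda>b. 2 * (1 - b) * (1 + p * (b * t / M))) has_integral 1 + p / 3 * (t / M)) {0..1}"
    by (simp add: mult.commute[of M 3])
  fix b :: real assume b: "b \<in> {0..1}"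
  then have "b * t \<le> 1 * t" using assms by (intro mult_right_mono) auto
  then have "b * t < M" using assms by linarith
  then have "b * t / M < 1" using M_pos by simp
  then show "2 * (1 - b) * (1 + p * (b * t / M)) \<le> 2 * (1 - b) * gamma_mgf M p (b * t)"
    unfolding gamma_mgf_def using b p_pos by (intro mult_left_mono one_plus_le_powr) auto
qed (rule beta_mixture[OF assms])

lemma one_le_cgf_ratio:
  assumes "0 < t" "t < M"
  shows "1 \<le> cgf_ratio M p t"
proof -
  have "0 \<le> p / 3 * (t / M)" using assms p_pos by simp
  then show ?thesis using cgf_ratio_lower[OF assms] by linarith
qed

text \<open>The comparison holds pointwise under the mixture integral.\<close>
lemma cgf_ratio_upper:
  assumes "0 < t" "1 \<le> k" "p \<le> 3 * k" "k * t / M < 1"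
  shows "cgf_ratio M p t \<le> 1 / (1 - k * t / M)"
proof (rule has_integral_le)
  have "t * 1 \<le> t * k" using assms by (intro mult_left_mono) auto
  also have "\<dots> < M" using assms M_pos by (simp add: mult.commute)
  finally have "t < M" by simp
  then show "((\<lambda>b. 2 * (1 - b) * gamma_mgf M p (b * t)) has_integral cgf_ratio M p t) {0..1}"
    using assms by (intro beta_mixture)
  show "((\<lambda>b. 2 * (1 - b) / (1 - k * t / M * b) ^ 3) has_integral 1 / (1 - k * t / M)) {0..1}"
    using assms by (intro beta_mixture_cauchy_cube)
  fix b :: real assume b: "b \<in> {0..1}"
  have "k * t / M * b \<le> k * t / M * 1" using b assms M_pos by (intro mult_left_mono) auto
  then have "k * (b * t / M) < 1" using assms by (simp add: mult_ac)
  then have "gamma_mgf M p (b * t) \<le> 1 / (1 - k * (b * t / M)) ^ 3"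
    unfolding gamma_mgf_def using b assms p_pos M_pos by (intro powr_le_inverse_cube) auto
  then have "2 * (1 - b) * gamma_mgf M p (b * t) \<le> 2 * (1 - b) * (1 / (1 - k * (b * t / M)) ^ 3)"
    using b by (intro mult_left_mono) auto
  then show "2 * (1 - b) * gamma_mgf M p (b * t) \<le> 2 * (1 - b) / (1 - k * t / M * b) ^ 3"
    by (simp add: mult_ac)
qed

end

lemma nn_integral_gamma_kernel:
  fixes r p :: real
  assumes "r > 0" "p > 0"
  shows "(\<integral>\<^sup>+ x. ennreal (x powr (p - 1) * exp (- r * x)) * indicator {0<..} x \<partial>lborel)
    = ennreal (Gamma p * r powr (- p))"
proof -
  have "(\<integral>\<^sup>+ x. ennreal (x powr (p - 1) * exp (- r * x)) * indicator {0<..} x \<partial>lborel)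
      = ennreal (1 / r) * (\<integral>\<^sup>+ x. ennreal ((x / r) powr (p - 1) * exp (- x)) * indicator {0<..} (x / r) \<partial>lborel)"
    using assms by (subst nn_integral_real_affine[where c = "1 / r" and t = 0]) auto
  also have "(\<integral>\<^sup>+ x. ennreal ((x / r) powr (p - 1) * exp (- x)) * indicator {0<..} (x / r) \<partial>lborel)
      = (\<integral>\<^sup>+ x. ennreal (r powr (1 - p)) * ennreal (indicator {0..} x * x powr (p - 1) / exp x) \<partial>lborel)"
  proof (intro nn_integral_cong)
    fix x :: real
    show "ennreal ((x / r) powr (p - 1) * exp (- x)) * indicator {0<..} (x / r)
        = ennreal (r powr (1 - p)) * ennreal (indicator {0..} x * x powr (p - 1) / exp x)"
    proof (cases "x > 0")
      case True
      have "r powr (1 - p) = 1 / r powr (p - 1)"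
        using powr_minus_divide[of r "p - 1"] by simp
      then show ?thesis using True assms
        by (simp add: powr_divide exp_minus field_simps flip: ennreal_mult)
    next
      case False
      then show ?thesis using assms by (cases "x = 0") (auto simp: zero_less_divide_iff)
    qed
  qed
  also have "\<dots> = ennreal (r powr (1 - p)) * ennreal (Gamma p)"
    by (subst nn_integral_cmult) (auto simp: Gamma_conv_nn_integral_real[OF assms(2)])
  also have "ennreal (1 / r) * \<dots> = ennreal (Gamma p * r powr (- p))"
  proof -
    have "1 / r * (r powr (1 - p) * Gamma p) = Gamma p * r powr (- p)"
      using assms powr_add[of r 1 "- p"] by simp
    then show ?thesis using assms Gamma_real_pos[of p] by (simp flip: ennreal_mult)
  qed
  finally show ?thesis .
qed

section \<open>Tempered stable Levy measures\<close>

lemma sigma_finite_beta_1_2_law: "sigma_finite_measure beta_1_2_law"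
proof -
  have "emeasure beta_1_2_law UNIV = (\<integral>\<^sup>+ b. ennreal (2 * (1 - b)) * indicator {0<..<1} b \<partial>lborel)"
    unfolding beta_1_2_law_def by (subst emeasure_density) auto
  also have "\<dots> \<le> (\<integral>\<^sup>+ b. 2 * indicator {0<..<1} (b::real) \<partial>lborel)"
    by (intro nn_integral_mono) (auto simp: indicator_def ennreal_le_iff2 simp flip: ennreal_numeral)
  also have "\<dots> < \<infinity>" by (simp add: nn_integral_cmult_indicator)
  finally have "finite_measure beta_1_2_law"
    by (intro finite_measureI) (simp add: beta_1_2_law_def)
  then show ?thesis by (rule finite_measure.axioms)
qed

lemma sets_beta_1_2_law [measurable_cong, simp]: "sets beta_1_2_law = sets borel"
  by (simp add: beta_1_2_law_def)

context positive_second_moment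
begin

lemma nn_integral_square: "(\<integral>\<^sup>+ x. ennreal (x\<^sup>2) \<partial>\<sigma>) = ennreal second_moment"
  using integrable_square by (rule nn_integral_eq_integral) auto

lemma nn_integral_square_bias:
  assumes [measurable]: "g \<in> borel_measurable borel"
  shows "(\<integral>\<^sup>+ x. g x \<partial>square_bias \<sigma>) = (\<integral>\<^sup>+ x. ennreal (x\<^sup>2) * g x \<partial>\<sigma>) / ennreal second_moment"
proof -
  have "(\<integral>\<^sup>+ x. g x \<partial>square_bias \<sigma>) = (\<integral>\<^sup>+ x. (ennreal (x\<^sup>2) * g x) / ennreal second_moment \<partial>\<sigma>)"
    unfolding square_bias_def using second_moment_pos
    by (subst nn_integral_density) (auto intro!: nn_integral_cong simp: divide_ennreal[symmetric]
        divide_ennreal_def mult_ac)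
  also have "\<dots> = (\<integral>\<^sup>+ x. ennreal (x\<^sup>2) * g x \<partial>\<sigma>) / ennreal second_moment"
    by (rule nn_integral_divide) measurable
  finally show ?thesis .
qed

lemma Z_law_eq_square_bias: "Z_law 0 \<sigma> = square_bias \<sigma>"
proof (rule measure_eqI)
  show "sets (Z_law 0 \<sigma>) = sets (square_bias \<sigma>)"
    unfolding Z_law_def H_measure_def
    by (simp add: sets_measure_of_conv sets.sigma_sets_eq[of borel, simplified])
  fix A assume "A \<in> sets (Z_law 0 \<sigma>)"
  then have A [measurable]: "A \<in> sets borel"
    unfolding \<open>sets (Z_law 0 \<sigma>) = sets (square_bias \<sigma>)\<close> by simp
  have "emeasure (H_measure 0 \<sigma>) UNIV = ennreal second_moment"
    by (subst emeasure_H_measure) (auto simp: nn_integral_square)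
  then have "emeasure (Z_law 0 \<sigma>) A = (\<integral>\<^sup>+ x. ennreal (x\<^sup>2) * indicator A x \<partial>\<sigma>) / ennreal second_moment"
    unfolding Z_law_def by (simp add: emeasure_H_measure divide_ennreal_def mult_ac)
  also have "\<dots> = (\<integral>\<^sup>+ x. indicator A x \<partial>square_bias \<sigma>)"
    by (rule nn_integral_square_bias[symmetric]) measurable
  finally show "emeasure (Z_law 0 \<sigma>) A = emeasure (square_bias \<sigma>) A" by simp
qed

lemma measurable_mgf_square_bias:
  "(\<lambda>b. mgf (square_bias \<sigma>) (\<lambda>z. z) (b * t)) \<in> borel_measurable borel"
proof -
  interpret prob_space "square_bias \<sigma>" by (rule prob_space_square_bias)
  show ?thesis unfolding mgf_def by measurable
qed

lemma mgf_zero_bias: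
  "mgf (zero_bias \<sigma>) (\<lambda>w. w) t = (\<integral>\<^sup>+ b. mgf (square_bias \<sigma>) (\<lambda>z. z) (b * t) \<partial>unit_uniform)"
proof -
  interpret pair_prob_space "square_bias \<sigma>" unit_uniform by (rule pair_prob)
  have "mgf (zero_bias \<sigma>) (\<lambda>w. w) t = (\<integral>\<^sup>+ x. ennreal (exp (t * (snd x * fst x))) \<partial>(square_bias \<sigma> \<Otimes>\<^sub>M unit_uniform))"
    unfolding zero_bias_def mgf_def by (subst nn_integral_distr) (auto simp: split_beta)
  also have "\<dots> = (\<integral>\<^sup>+ b. \<integral>\<^sup>+ z. ennreal (exp (t * (b * z))) \<partial>square_bias \<sigma> \<partial>unit_uniform)"
    by (subst nn_integral_snd[symmetric]) (auto simp: split_beta)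
  finally show ?thesis unfolding mgf_def by (simp add: mult_ac)
qed

lemma mgf_R_law:
  "mgf (R_law 0 \<sigma>) (\<lambda>r. r) t =
    (\<integral>\<^sup>+ b. ennreal (2 * (1 - b)) * indicator {0<..<1} b * mgf (square_bias \<sigma>) (\<lambda>z. z) (b * t) \<partial>lborel)"
proof -
  interpret Z: prob_space "square_bias \<sigma>" by (rule prob_space_square_bias)
  interpret pair_sigma_finite beta_1_2_law "square_bias \<sigma>"
    by (intro pair_sigma_finite.intro sigma_finite_beta_1_2_law Z.sigma_finite_measure_axioms)
  have "mgf (R_law 0 \<sigma>) (\<lambda>r. r) t = (\<integral>\<^sup>+ x. ennreal (exp (t * (fst x * snd x))) \<partial>(beta_1_2_law \<Otimes>\<^sub>M square_bias \<sigma>))"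
    unfolding R_law_def Z_law_eq_square_bias mgf_def by (subst nn_integral_distr) (auto simp: split_beta)
  also have "\<dots> = (\<integral>\<^sup>+ b. \<integral>\<^sup>+ z. ennreal (exp (t * (b * z))) \<partial>square_bias \<sigma> \<partial>beta_1_2_law)"
    by (subst Z.nn_integral_fst[symmetric]) (auto simp: split_beta)
  also have "\<dots> = (\<integral>\<^sup>+ b. mgf (square_bias \<sigma>) (\<lambda>z. z) (b * t) \<partial>beta_1_2_law)"
    unfolding mgf_def by (simp add: mult_ac)
  also have "\<dots> = (\<integral>\<^sup>+ b. ennreal (2 * (1 - b)) * indicator {0<..<1} b * mgf (square_bias \<sigma>) (\<lambda>z. z) (b * t) \<partial>lborel)"
    unfolding beta_1_2_law_def mgf_def by (subst nn_integral_density) auto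
  finally show ?thesis .
qed

end

locale tempered_stable =
  fixes Y C M :: real
  assumes Y_less: "Y < 2" and C_pos: "C > 0" and M_positive: "M > 0"
begin

abbreviation "p \<equiv> 2 - Y"
abbreviation "levy \<equiv> tempered_stable_levy Y C M"
definition "levy_variance = C * Gamma p * M powr (Y - 2)"

sublocale gamma_mixture M p
  using Y_less M_positive by unfold_locales auto

lemma levy_variance_pos: "levy_variance > 0"
  using Y_less C_pos M_pos by (simp add: levy_variance_def Gamma_real_pos)

lemma sets_tempered_stable_levy [measurable_cong, simp]: "sets levy = sets borel"
  by (simp add: tempered_stable_levy_def)

lemma nn_integral_tilted_square:
  assumes "t < M"
  shows "(\<integral>\<^sup>+ x. ennreal (x\<^sup>2) * ennreal (exp (t * x)) \<partial>levy) = ennreal (levy_variance * gamma_mgf M p t)"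
proof -
  have "(\<integral>\<^sup>+ x. ennreal (x\<^sup>2) * ennreal (exp (t * x)) \<partial>levy) =
      (\<integral>\<^sup>+ x. ennreal C * (ennreal (x powr (p - 1) * exp (- (M - t) * x)) * indicator {0<..} x) \<partial>lborel)"
    unfolding tempered_stable_levy_def
  proof (subst nn_integral_density)
    show "(\<integral>\<^sup>+ x. ennreal (C * x powr (- 1 - Y) * exp (- M * x)) * indicator {0<..} x *
        (ennreal (x\<^sup>2) * ennreal (exp (t * x))) \<partial>lborel) =
      (\<integral>\<^sup>+ x. ennreal C * (ennreal (x powr (p - 1) * exp (- (M - t) * x)) * indicator {0<..} x) \<partial>lborel)"
    proof (intro nn_integral_cong)
      fix x :: real
      have "C * x powr (- 1 - Y) * exp (- M * x) * (x\<^sup>2 * exp (t * x)) = C * (x powr (p - 1) * exp (- (M - t) * x))" if "x > 0"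
      proof -
        have "x powr (p - 1) = x powr (- 1 - Y) * x\<^sup>2"
          using that powr_add[of x "- 1 - Y" 2] by simp
        moreover have "exp (- (M - t) * x) = exp (- M * x) * exp (t * x)"
          by (simp add: exp_add[symmetric] algebra_simps)
        ultimately show ?thesis by simp
      qed
      then show "ennreal (C * x powr (- 1 - Y) * exp (- M * x)) * indicator {0<..} x *
          (ennreal (x\<^sup>2) * ennreal (exp (t * x))) =
        ennreal C * (ennreal (x powr (p - 1) * exp (- (M - t) * x)) * indicator {0<..} x)"
        using C_pos by (auto simp: indicator_def simp flip: ennreal_mult)
    qed
  qed auto
  also have "\<dots> = ennreal C * ennreal (Gamma p * (M - t) powr (- p))"
    using assms Y_less by (subst nn_integral_cmult) (simp_all only: nn_integral_gamma_kernel, auto)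
  also have "\<dots> = ennreal (levy_variance * gamma_mgf M p t)"
  proof -
    have "M - t = M * (1 - t / M)" using M_pos by (simp add: field_simps)
    then have "(M - t) powr (- p) = M powr (- p) * (1 - t / M) powr (- p)"
      using assms M_pos by (simp add: powr_mult)
    then show ?thesis
      using C_pos Y_less Gamma_real_pos[of p] M_pos
      by (simp add: levy_variance_def gamma_mgf_def mult_ac flip: ennreal_mult)
  qed
  finally show ?thesis .
qed

sublocale levy: positive_second_moment levy
proof
  have sq: "(\<integral>\<^sup>+ x. ennreal (x\<^sup>2) \<partial>levy) = ennreal levy_variance"
    using nn_integral_tilted_square[OF M_pos] by (simp add: gamma_mgf_def)
  show int: "integrable levy (\<lambda>x. x\<^sup>2)"
    by (rule integrableI_nonneg) (auto simp: sq)
  show "(\<integral>x. x\<^sup>2 \<partial>levy) > 0"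
    using nn_integral_eq_integral[OF int] levy_variance_pos by (simp add: sq)
qed simp

lemma second_moment_levy: "levy.second_moment = levy_variance"
proof -
  have "ennreal levy.second_moment = ennreal levy_variance"
    using nn_integral_tilted_square[OF M_pos] by (simp add: gamma_mgf_def levy.nn_integral_square)
  then show ?thesis using levy_variance_pos levy.second_moment_pos by (simp add: ennreal_inj)
qed

lemma mgf_square_bias:
  assumes "t < M"
  shows "mgf (square_bias levy) (\<lambda>z. z) t = ennreal (gamma_mgf M p t)"
  unfolding mgf_def
  by (subst levy.nn_integral_square_bias)
    (use levy_variance_pos gamma_mgf_pos[OF assms] in
      \<open>auto simp: nn_integral_tilted_square[OF assms] second_moment_levy divide_ennreal\<close>)

lemma AE_levy_pos: "AE x in levy. x > 0"
  unfolding tempered_stable_levy_def by (subst AE_density) (auto simp: indicator_def)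

text \<open>At and beyond \<open>M\<close> the integral dominates its values at all \<open>s < M\<close>, because the mass sits on the positive
half-line, and those are unbounded as \<open>p > 0\<close>.\<close>
lemma mgf_square_bias_infinite:
  assumes "M \<le> t"
  shows "mgf (square_bias levy) (\<lambda>z. z) t = \<infinity>"
proof (rule ccontr)
  assume "\<not> ?thesis"
  then obtain c where c: "mgf (square_bias levy) (\<lambda>z. z) t = ennreal c" "c \<ge> 0"
    by (cases "mgf (square_bias levy) (\<lambda>z. z) t") auto
  \<comment> \<open>The point \<open>M (1 - d)\<close> is where the generating function equals \<open>c + 2\<close>; adding 2 rather than 1 keeps \<open>d < 1\<close>.\<close>
  define d where "d = (c + 2) powr (- 1 / p)"
  have d: "0 < d" "d < 1"
    using c Y_less by (auto simp: d_def intro!: powr_less_one)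
  define s where "s = M * (1 - d)"
  have s: "s < M" using d M_pos by (simp add: s_def)
  have AE: "AE x in square_bias levy. x > 0"
    unfolding square_bias_def using AE_levy_pos by (subst AE_density) auto
  have "ennreal (gamma_mgf M p s) = mgf (square_bias levy) (\<lambda>z. z) s"
    using mgf_square_bias[OF s] ..
  also have "\<dots> \<le> mgf (square_bias levy) (\<lambda>z. z) t"
    unfolding mgf_def using AE s assms
    by (intro nn_integral_mono_AE) (auto elim!: eventually_mono intro!: ennreal_leI mult_right_mono)
  finally have "gamma_mgf M p s \<le> c" using c by simp
  moreover have "gamma_mgf M p s = c + 2"
  proof -
    have "gamma_mgf M p s = (c + 2) powr ((- 1 / p) * (- p))"
      using M_pos unfolding gamma_mgf_def s_def d_def powr_powr[symmetric] by simp
    also have "(- 1 / p) * (- p) = 1" using p_pos by (simp add: field_simps)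
    finally show ?thesis using c by simp
  qed
  ultimately show False by simp
qed

lemma mgf_zero_bias_levy:
  assumes "0 < t" "t < M"
  shows "mgf (zero_bias levy) (\<lambda>w. w) t = ennreal (unit_cgf_deriv M p t / t)"
proof -
  note lt = scale_less[OF assms]
  have "mgf (zero_bias levy) (\<lambda>w. w) t = (\<integral>\<^sup>+ b. mgf (square_bias levy) (\<lambda>z. z) (b * t) * indicator {0..1} b \<partial>lborel)"
    unfolding levy.mgf_zero_bias by (rule nn_integral_unit_uniform) (rule levy.measurable_mgf_square_bias)
  also have "\<dots> = (\<integral>\<^sup>+ b. ennreal (gamma_mgf M p (b * t)) * indicator {0..1} b \<partial>lborel)"
    by (intro nn_integral_cong) (auto simp: indicator_def mgf_square_bias lt)
  also have "\<dots> = ennreal (unit_cgf_deriv M p t / t)"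
  proof (rule nn_integral_has_integral_lebesgue')
    show "0 \<le> gamma_mgf M p (b * t)" for b by (simp add: gamma_mgf_def)
    show "((\<lambda>b. gamma_mgf M p (b * t)) has_integral unit_cgf_deriv M p t / t) {0..1}"
      using has_integral_mult_left[OF uniform_mixture[OF assms], of "1 / t"] assms by simp
  qed
  finally show ?thesis .
qed

text \<open>The uniform factor gives mass to \<open>b > M / t\<close>, where the inner generating function is infinite.\<close>
lemma mgf_zero_bias_levy_infinite:
  assumes "M < t"
  shows "mgf (zero_bias levy) (\<lambda>w. w) t = \<infinity>"
proof -
  have t: "0 < t" "M / t < 1" using assms M_pos by auto
  have "(\<infinity>::ennreal) = (\<integral>\<^sup>+ b. \<infinity> * indicator {M / t..1} b \<partial>lborel)"
    using t by (subst nn_integral_cmult_indicator) (auto simp: ennreal_top_mult)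
  also have "\<dots> \<le> (\<integral>\<^sup>+ b. mgf (square_bias levy) (\<lambda>z. z) (b * t) * indicator {0..1} b \<partial>lborel)"
  proof (rule nn_integral_mono)
    fix b :: real
    show "\<infinity> * indicator {M / t..1} b \<le> mgf (square_bias levy) (\<lambda>z. z) (b * t) * indicator {0..1} b"
    proof (cases "b \<in> {M / t..1}")
      case True
      then have "M \<le> b * t" using t by (simp add: pos_divide_le_eq)
      moreover have "0 \<le> M / t" using t M_pos by simp
      then have "0 \<le> b" using True by auto
      ultimately show ?thesis using True mgf_square_bias_infinite by simp
    qed auto
  qed
  also have "\<dots> = mgf (zero_bias levy) (\<lambda>w. w) t"
    unfolding levy.mgf_zero_bias by (rule nn_integral_unit_uniform[symmetric]) (rule levy.measurable_mgf_square_bias)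
  finally show ?thesis by (simp add: top_unique)
qed

lemma mgf_R_law_levy:
  assumes "0 < t" "t < M"
  shows "mgf (R_law 0 levy) (\<lambda>r. r) t = ennreal (cgf_ratio M p t)"
proof -
  note lt = scale_less[OF assms]
  have "mgf (R_law 0 levy) (\<lambda>r. r) t =
      (\<integral>\<^sup>+ b. ennreal (2 * (1 - b) * gamma_mgf M p (b * t)) * indicator {0..1} b \<partial>lborel)"
    unfolding levy.mgf_R_law
  proof (rule nn_integral_cong_AE)
    have "AE b in lborel. b \<noteq> (0::real)" "AE b in lborel. b \<noteq> (1::real)"
      using AE_lborel_singleton by auto
    then show "AE b in lborel. ennreal (2 * (1 - b)) * indicator {0<..<1} b * mgf (square_bias levy) (\<lambda>z. z) (b * t)
        = ennreal (2 * (1 - b) * gamma_mgf M p (b * t)) * indicator {0..1} b"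
      by eventually_elim (auto simp: indicator_def mgf_square_bias lt ennreal_mult gamma_mgf_def)
  qed
  also have "\<dots> = ennreal (cgf_ratio M p t)"
    by (intro nn_integral_has_integral_lebesgue' beta_mixture assms) (auto simp: gamma_mgf_def)
  finally show ?thesis .
qed

lemma Psi1_tempered_stable:
  assumes "0 < t" "t < M"
  shows "Psi1 0 levy t = (1 - 1 / cgf_ratio M p t) / t"
proof -
  have "1 \<le> cgf_ratio M p t" by (rule one_le_cgf_ratio[OF assms])
  then have "1 / ennreal (cgf_ratio M p t) = ennreal (1 / cgf_ratio M p t)"
    by (simp add: divide_ennreal flip: ennreal_1)
  then show ?thesis
    unfolding Psi1_def mgf_R_law_levy[OF assms] using \<open>1 \<le> cgf_ratio M p t\<close> by simp
qed

text \<open>The linear lower bound and the rational upper bound for \<open>cgf_ratio\<close> have the same slope \<open>p / (3 M)\<close> at 0 when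
\<open>p \<ge> 3\<close>, so they squeeze the limit.\<close>
lemma Psi1_tendsto:
  assumes "Y \<le> - 1"
  shows "(Psi1 0 levy \<longlongrightarrow> p / (3 * M)) (at_right 0)"
proof (rule real_tendsto_sandwich)
  let ?k = "p / 3"
  have k: "1 \<le> ?k" using assms by simp
  have "\<forall>\<^sub>F t in at_right 0. 0 < t \<and> t < M / ?k"
    using M_pos k by (intro eventually_at_right_real[THEN eventually_mono]) auto
  then have ev: "\<forall>\<^sub>F t in at_right 0. ?k / M / (1 + ?k * t / M) \<le> Psi1 0 levy t \<and> Psi1 0 levy t \<le> ?k / M"
  proof eventually_elim
    case (elim t)
    then have t: "0 < t" "?k * t / M < 1" using M_pos k by (auto simp: field_simps)
    have "1 * t \<le> ?k * t" using k t by (intro mult_right_mono) auto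
    also have "\<dots> < M" using t M_pos by (simp add: field_simps)
    finally have tM: "t < M" by simp
    let ?A = "cgf_ratio M p t"
    have pos: "0 < 1 + ?k * t / M" using t k M_pos by (intro add_pos_nonneg) auto
    have lower: "1 + ?k * t / M \<le> ?A" using cgf_ratio_lower[OF t(1) tM] by simp
    have upper: "?A \<le> 1 / (1 - ?k * t / M)" using t k by (intro cgf_ratio_upper) auto
    have "1 - ?k * t / M \<le> 1 / ?A"
      using upper lower pos t by (simp add: field_simps)
    then have "(1 - 1 / ?A) / t \<le> (?k * t / M) / t"
      using t by (intro divide_right_mono) auto
    moreover have "1 / ?A \<le> 1 / (1 + ?k * t / M)"
      using lower pos by (intro divide_left_mono mult_pos_pos) auto
    then have "(1 - 1 / (1 + ?k * t / M)) / t \<le> (1 - 1 / ?A) / t"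
      using t by (intro divide_right_mono) auto
    moreover have "(1 - 1 / (1 + ?k * t / M)) / t = ?k / M / (1 + ?k * t / M)"
    proof -
      have "1 - 1 / (1 + ?k * t / M) = ?k * t / M / (1 + ?k * t / M)"
        using pos by (simp only: diff_divide_eq_iff less_imp_neq[symmetric] not_False_eq_True) simp
      then show ?thesis using t by simp
    qed
    ultimately show ?case
      unfolding Psi1_tempered_stable[OF t(1) tM] using t by simp
  qed
  show "\<forall>\<^sub>F t in at_right 0. ?k / M / (1 + ?k * t / M) \<le> Psi1 0 levy t"
    using ev by eventually_elim simp
  show "\<forall>\<^sub>F t in at_right 0. Psi1 0 levy t \<le> ?k / M"
    using ev by eventually_elim simp
  have "((\<lambda>t. ?k / M / (1 + ?k * t / M)) \<longlongrightarrow> ?k / M / (1 + ?k * 0 / M)) (at_right 0)"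
    using M_pos by (intro tendsto_intros) auto
  then show "((\<lambda>t. ?k / M / (1 + ?k * t / M)) \<longlongrightarrow> p / (3 * M)) (at_right 0)" by simp
qed simp

end

section \<open>Exponential forms of the zero-bias identity\<close>

text \<open>Integrability of an exponential at \<open>T'\<close> dominates the derivatives of the exponentials at all smaller exponents.\<close>
lemma abs_mult_exp_le:
  fixes x t T T' :: real
  assumes "0 \<le> t" "t \<le> T" "T < T'"
  shows "\<bar>x\<bar> * exp (t * x) \<le> \<bar>x\<bar> + exp (T' * x) / (T' - T)"
proof (cases "x \<ge> 0")
  case True
  have "(T' - T) * x \<le> exp ((T' - T) * x)" using exp_ge_add_one_self[of "(T' - T) * x"] by linarith
  then have "x \<le> exp ((T' - T) * x) / (T' - T)" using assms by (simp add: field_simps)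
  moreover have "exp (t * x) \<le> exp (T * x)" using True assms by (simp add: mult_right_mono)
  ultimately have "x * exp (t * x) \<le> exp ((T' - T) * x) / (T' - T) * exp (T * x)"
    using True by (intro mult_mono) auto
  also have "\<dots> = exp (T' * x) / (T' - T)" by (simp add: exp_add[symmetric] algebra_simps)
  finally show ?thesis using True by simp
next
  case False
  then have "t * x \<le> 0" using assms by (simp add: mult_nonneg_nonpos)
  then have "exp (t * x) \<le> 1" by simp
  then have "\<bar>x\<bar> * exp (t * x) \<le> \<bar>x\<bar> * 1" by (intro mult_left_mono) auto
  moreover have "0 \<le> exp (T' * x) / (T' - T)" using assms by simp
  ultimately show ?thesis by linarith
qed

lemma mult_exp_diff_one_nonneg:
  fixes x y t :: real
  assumes "0 \<le> t" "0 \<le> x * y"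
  shows "0 \<le> x * (exp (t * y) - 1)"
proof (cases "0 \<le> x")
  case True
  then show ?thesis
    using assms by (cases "x = 0") (auto simp: zero_le_mult_iff)
next
  case False
  then have "y \<le> 0" using assms by (auto simp: zero_le_mult_iff)
  then have "exp (t * y) \<le> 1" using assms by (simp add: mult_nonneg_nonpos)
  then show ?thesis using False by (simp add: mult_nonpos_nonpos)
qed

text \<open>The upper limit \<open>y / x\<close> lets one computation serve both the exponential (\<open>y = x\<close>) and its truncation
(\<open>y = min x N\<close>).\<close>
lemma nn_integral_exp_segment:
  fixes x y t :: real
  assumes "0 \<le> t" "x \<noteq> 0" "0 \<le> y / x"
  shows "ennreal (x\<^sup>2) * (\<integral>\<^sup>+ b. ennreal (t * exp (t * (b * x))) * indicator {0..y / x} b \<partial>lborel)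
    = ennreal (x * (exp (t * y) - 1))"
proof -
  have "(\<integral>\<^sup>+ b. ennreal (t * exp (t * (b * x))) * indicator {0..y / x} b \<partial>lborel)
      = ennreal (exp (t * (y / x * x)) / x - exp (t * (0 * x)) / x)"
    using assms by (intro nn_integral_FTC_Icc) (auto intro!: derivative_eq_intros)
  also have "exp (t * (y / x * x)) / x - exp (t * (0 * x)) / x = (exp (t * y) - 1) / x"
    using assms by (simp add: diff_divide_distrib)
  also have "ennreal (x\<^sup>2) * ennreal \<dots> = ennreal (x\<^sup>2 * ((exp (t * y) - 1) / x))"
    by (rule ennreal_mult'[symmetric]) simp
  also have "x\<^sup>2 * ((exp (t * y) - 1) / x) = x * (exp (t * y) - 1)"
    using assms by (simp add: power2_eq_square)
  finally show ?thesis .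
qed

lemma (in positive_second_moment) AE_zero_bias_nonneg:
  assumes "AE x in \<sigma>. 0 \<le> x"
  shows "AE w in zero_bias \<sigma>. 0 \<le> w"
proof -
  have "(\<integral>\<^sup>+ w. indicator {..<0} w \<partial>zero_bias \<sigma>) =
      (\<integral>\<^sup>+ z. ennreal (z\<^sup>2 / second_moment) * (\<integral>\<^sup>+ b. indicator {..<0} (b * z) \<partial>unit_uniform) \<partial>\<sigma>)"
    by (rule nn_integral_zero_bias) measurable
  also have "\<dots> = (\<integral>\<^sup>+ z. 0 \<partial>\<sigma>)"
  proof (rule nn_integral_cong_AE)
    from assms show "AE z in \<sigma>. ennreal (z\<^sup>2 / second_moment) * (\<integral>\<^sup>+ b. indicator {..<0} (b * z) \<partial>unit_uniform) = 0"
    proof eventually_elim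
      case (elim z)
      have "(\<integral>\<^sup>+ b. indicator {..<0} (b * z) \<partial>unit_uniform) = (\<integral>\<^sup>+ b. indicator {..<0} (b * z) * indicator {0..1} b \<partial>lborel)"
        by (rule nn_integral_unit_uniform) measurable
      also have "\<dots> = (\<integral>\<^sup>+ (b::real). 0 \<partial>lborel)"
        using elim by (intro nn_integral_cong) (auto simp: indicator_def mult_less_0_iff)
      finally show ?case by simp
    qed
  qed
  finally have "emeasure (zero_bias \<sigma>) {..<0} = 0" by simp
  then show ?thesis
    by (intro AE_I'[of "{..<0}"]) (auto simp: null_sets_def)
qed

context centered_inf_div
begin

lemma zero_bias_identity:
  assumes [measurable]: "g \<in> borel_measurable borel"
  shows "(\<integral>\<^sup>+ x. ennreal (x\<^sup>2) * (\<integral>\<^sup>+ b. g (b * x) \<partial>unit_uniform) \<partial>\<mu>)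
    = ennreal V * (\<integral>\<^sup>+ x. \<integral>\<^sup>+ w. g (x + w) \<partial>zero_bias \<nu> \<partial>\<mu>)"
proof -
  interpret U: prob_space unit_uniform by (rule prob_space_unit_uniform)
  have [measurable_cong]: "sets (zero_bias \<nu>) = sets borel" by simp
  have "(\<integral>\<^sup>+ x. ennreal (x\<^sup>2) * (\<integral>\<^sup>+ b. g (b * x) \<partial>unit_uniform) \<partial>\<mu>)
      = (\<integral>\<^sup>+ x. ennreal V * (ennreal (x\<^sup>2 / V) * (\<integral>\<^sup>+ b. g (b * x) \<partial>unit_uniform)) \<partial>\<mu>)"
  proof (rule nn_integral_cong)
    fix x
    have "ennreal (x\<^sup>2) = ennreal V * ennreal (x\<^sup>2 / V)"
      using variance_pos by (subst ennreal_mult[symmetric]) auto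
    then show "ennreal (x\<^sup>2) * (\<integral>\<^sup>+ b. g (b * x) \<partial>unit_uniform) =
        ennreal V * (ennreal (x\<^sup>2 / V) * (\<integral>\<^sup>+ b. g (b * x) \<partial>unit_uniform))"
      by (simp only: mult.assoc)
  qed
  also have "\<dots> = ennreal V * (\<integral>\<^sup>+ w. g w \<partial>zero_bias \<mu>)"
    unfolding law.nn_integral_zero_bias[OF assms] second_moment_distr by (rule nn_integral_cmult) measurable
  also have "(\<integral>\<^sup>+ w. g w \<partial>zero_bias \<mu>) = (\<integral>\<^sup>+ x. \<integral>\<^sup>+ w. g (x + w) \<partial>zero_bias \<nu> \<partial>\<mu>)"
    unfolding zero_bias_eq_sum
    by (subst nn_integral_distr) (auto simp: split_beta simp flip: zb_levy.nn_integral_fst)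
  finally show ?thesis .
qed

text \<open>If everything is finite, this says that the derivative of the moment generating function \<open>m\<close> is \<open>K' m\<close>, where \<open>K'\<close>
is the derivative of the exponent. Both sides are integrals of nonnegative functions, so that it also holds when they are
infinite: this is how divergence of the exponential moments of the Levy measure passes to \<open>X\<close>.\<close>
lemma exponential_zero_bias_identity:
  assumes "0 \<le> t"
  shows "(\<integral>\<^sup>+ x. ennreal (x * (exp (t * x) - 1)) \<partial>\<mu>)
    = ennreal (V * t) * (mgf \<mu> (\<lambda>x. x) t * mgf (zero_bias \<nu>) (\<lambda>w. w) t)"
proof -
  have [measurable_cong]: "sets (zero_bias \<nu>) = sets borel" by simp
  have "ennreal (x * (exp (t * x) - 1)) = ennreal (x\<^sup>2) * (\<integral>\<^sup>+ b. ennreal (t * exp (t * (b * x))) \<partial>unit_uniform)" for x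
  proof (cases "x = 0")
    case False
    then show ?thesis
      using nn_integral_exp_segment[OF assms False, of x] by (subst nn_integral_unit_uniform) auto
  qed simp
  then have "(\<integral>\<^sup>+ x. ennreal (x * (exp (t * x) - 1)) \<partial>\<mu>)
      = ennreal V * (\<integral>\<^sup>+ x. \<integral>\<^sup>+ w. ennreal (t * exp (t * (x + w))) \<partial>zero_bias \<nu> \<partial>\<mu>)"
    by (simp only:) (rule zero_bias_identity, measurable)
  also have "(\<integral>\<^sup>+ x. \<integral>\<^sup>+ w. ennreal (t * exp (t * (x + w))) \<partial>zero_bias \<nu> \<partial>\<mu>)
      = (\<integral>\<^sup>+ x. \<integral>\<^sup>+ w. (ennreal t * ennreal (exp (t * x))) * ennreal (exp (t * w)) \<partial>zero_bias \<nu> \<partial>\<mu>)"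
    using assms by (simp add: ring_distribs exp_add mult.assoc flip: ennreal_mult)
  also have "\<dots> = ennreal t * (mgf \<mu> (\<lambda>x. x) t * mgf (zero_bias \<nu>) (\<lambda>w. w) t)"
    unfolding mgf_def
    by (subst nn_integral_cmult, measurable) (subst nn_integral_multc, measurable, subst nn_integral_cmult, auto simp: mult.assoc)
  finally show ?thesis
    using assms by (simp only: ennreal_mult'' mult.assoc)
qed

text \<open>The moments of \<open>X\<close> on the right are finite for every \<open>t\<close>, hence this version is usable before \<open>X\<close> is known to have exponential
moments. Positivity of the jumps enters through \<open>w \<ge> 0\<close>: if \<open>x + w \<le> N\<close> then already \<open>x \<le> N\<close>.\<close>
lemma truncated_zero_bias_inequality:
  assumes "0 \<le> t" "0 \<le> N" and pos: "AE x in \<nu>. 0 \<le> x"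
  shows "(\<integral>\<^sup>+ x. ennreal (x * (exp (t * min x N) - 1)) \<partial>\<mu>)
    \<le> ennreal (V * t) * ((\<integral>\<^sup>+ x. ennreal (exp (t * min x N)) \<partial>\<mu>) * mgf (zero_bias \<nu>) (\<lambda>w. w) t)"
proof -
  have [measurable_cong]: "sets (zero_bias \<nu>) = sets borel" by simp
  \<comment> \<open>the derivative, away from \<open>w = N\<close>, of the truncated exponential \<open>exp (t * min w N)\<close>\<close>
  define g where "g = (\<lambda>w. ennreal (t * exp (t * w)) * indicator {..N} w)"
  have [measurable]: "g \<in> borel_measurable borel" unfolding g_def by measurable
  have "ennreal (x * (exp (t * min x N) - 1)) \<le> ennreal (x\<^sup>2) * (\<integral>\<^sup>+ b. g (b * x) \<partial>unit_uniform)" for x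
  proof (cases "x = 0")
    case False
    have ratio: "0 \<le> min x N / x" "min x N / x \<le> 1"
      using False assms by (auto simp: min_def divide_le_eq_1 zero_le_divide_iff)
    have "ennreal (x * (exp (t * min x N) - 1))
        = ennreal (x\<^sup>2) * (\<integral>\<^sup>+ b. ennreal (t * exp (t * (b * x))) * indicator {0..min x N / x} b \<partial>lborel)"
      by (rule nn_integral_exp_segment[symmetric]) (use assms False ratio in auto)
    also have "\<dots> \<le> ennreal (x\<^sup>2) * (\<integral>\<^sup>+ b. g (b * x) * indicator {0..1} b \<partial>lborel)"
    proof (intro mult_left_mono nn_integral_mono)
      fix b :: real
      have "b * x \<le> N" if "0 \<le> b" "b \<le> min x N / x"
      proof (cases "x > 0")
        case True
        then show ?thesis using that by (simp add: pos_le_divide_eq)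
      next
        case False
        then show ?thesis using that assms by (smt (verit) mult_nonneg_nonpos)
      qed
      then show "ennreal (t * exp (t * (b * x))) * indicator {0..min x N / x} b \<le> g (b * x) * indicator {0..1} b"
        using ratio by (auto simp: g_def indicator_def)
    qed simp
    also have "(\<integral>\<^sup>+ b. g (b * x) * indicator {0..1} b \<partial>lborel) = (\<integral>\<^sup>+ b. g (b * x) \<partial>unit_uniform)"
      by (rule nn_integral_unit_uniform[symmetric]) measurable
    finally show ?thesis .
  qed simp
  then have "(\<integral>\<^sup>+ x. ennreal (x * (exp (t * min x N) - 1)) \<partial>\<mu>)
      \<le> (\<integral>\<^sup>+ x. ennreal (x\<^sup>2) * (\<integral>\<^sup>+ b. g (b * x) \<partial>unit_uniform) \<partial>\<mu>)"
    by (rule nn_integral_mono)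
  also have "\<dots> = ennreal V * (\<integral>\<^sup>+ x. \<integral>\<^sup>+ w. g (x + w) \<partial>zero_bias \<nu> \<partial>\<mu>)"
    by (rule zero_bias_identity) measurable
  also have "(\<integral>\<^sup>+ x. \<integral>\<^sup>+ w. g (x + w) \<partial>zero_bias \<nu> \<partial>\<mu>)
      \<le> (\<integral>\<^sup>+ x. \<integral>\<^sup>+ w. (ennreal t * ennreal (exp (t * min x N))) * ennreal (exp (t * w)) \<partial>zero_bias \<nu> \<partial>\<mu>)"
  proof (rule nn_integral_mono, rule nn_integral_mono_AE)
    fix x
    show "AE w in zero_bias \<nu>. g (x + w) \<le> (ennreal t * ennreal (exp (t * min x N))) * ennreal (exp (t * w))"
      using levy.AE_zero_bias_nonneg[OF pos]
    proof eventually_elim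
      case (elim w)
      show ?case
      proof (cases "x + w \<le> N")
        case True
        then have "min x N = x" using elim by simp
        then show ?thesis
          using True assms by (simp add: g_def ring_distribs exp_add mult.assoc flip: ennreal_mult)
      qed (simp add: g_def)
    qed
  qed
  also have "\<dots> = ennreal t * ((\<integral>\<^sup>+ x. ennreal (exp (t * min x N)) \<partial>\<mu>) * mgf (zero_bias \<nu>) (\<lambda>w. w) t)"
    unfolding mgf_def
    by (subst nn_integral_cmult, measurable) (subst nn_integral_multc, measurable, subst nn_integral_cmult, auto simp: mult.assoc)
  finally show ?thesis
    using assms by (simp only: ennreal_mult'' mult.assoc mult_left_mono zero_le)
qed

end

section \<open>Moment generating function of the tempered stable variable\<close>

locale tempered_stable_rv = tempered_stable Y C M + centered_inf_div P X "tempered_stable_levy Y C M"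
  for Y C M :: real and P :: "'a measure" and X :: "'a \<Rightarrow> real"
begin

lemma V_eq: "V = levy_variance"
  using variance_eq_levy_second_moment second_moment_levy by simp

lemma mgf_law: "mgf \<mu> (\<lambda>x. x) t = mgf P X t"
  unfolding mgf_def by (subst nn_integral_distr) auto

lemma integrable_law: "integrable \<mu> (\<lambda>x. x)" "(\<integral>x. x \<partial>\<mu>) = 0"
  by (simp_all add: integrable_distr_eq integrable_X integral_distr mean_zero)

lemma AE_levy_nonneg: "AE x in levy. 0 \<le> x"
  using AE_levy_pos by eventually_elim simp

text \<open>For \<open>t\<close> strictly between \<open>M\<close> and \<open>T\<close>, finiteness at \<open>T\<close> would make the left-hand side of
\<open>exponential_zero_bias_identity\<close> finite, whereas its right-hand side is infinite.\<close>
lemma mgf_infinite: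
  assumes "M < T"
  shows "mgf P X T = \<infinity>"
proof (rule ccontr)
  assume "mgf P X T \<noteq> \<infinity>"
  then have fin: "(\<integral>\<^sup>+ x. ennreal (exp (T * x)) \<partial>\<mu>) < \<infinity>"
    unfolding mgf_law[symmetric] unfolding mgf_def by (simp add: top.not_eq_extremum)
  define t where "t = (M + T) / 2"
  have t: "0 < t" "M < t" "t < T" using assms M_pos by (auto simp: t_def)
  have "(\<integral>\<^sup>+ x. ennreal (x * (exp (t * x) - 1)) \<partial>\<mu>)
      \<le> (\<integral>\<^sup>+ x. ennreal \<bar>x\<bar> + (ennreal \<bar>x\<bar> + ennreal (1 / (T - t)) * ennreal (exp (T * x))) \<partial>\<mu>)"
  proof (rule nn_integral_mono)
    fix x :: real
    have "x * (exp (t * x) - 1) \<le> \<bar>x\<bar> * exp (t * x) + \<bar>x\<bar>"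
    proof -
      have "x * exp (t * x) \<le> \<bar>x\<bar> * exp (t * x)" by (rule mult_right_mono) auto
      then show ?thesis using abs_ge_minus_self[of x] unfolding right_diff_distrib by linarith
    qed
    also have "\<dots> \<le> \<bar>x\<bar> + (\<bar>x\<bar> + 1 / (T - t) * exp (T * x))"
      using abs_mult_exp_le[of t t T x] t by simp
    finally show "ennreal (x * (exp (t * x) - 1)) \<le> ennreal \<bar>x\<bar> + (ennreal \<bar>x\<bar> + ennreal (1 / (T - t)) * ennreal (exp (T * x)))"
      using t by (simp add: ennreal_leI flip: ennreal_mult ennreal_plus)
  qed
  also have "\<dots> = (\<integral>\<^sup>+ x. ennreal \<bar>x\<bar> \<partial>\<mu>) + ((\<integral>\<^sup>+ x. ennreal \<bar>x\<bar> \<partial>\<mu>) + ennreal (1 / (T - t)) * (\<integral>\<^sup>+ x. ennreal (exp (T * x)) \<partial>\<mu>))"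
    by (simp add: nn_integral_add nn_integral_cmult)
  also have "\<dots> < \<infinity>"
    using fin integrable_law(1) by (simp add: integrable_iff_bounded ennreal_mult_less_top)
  finally have "ennreal (V * t) * (mgf \<mu> (\<lambda>x. x) t * \<infinity>) < \<infinity>"
    using exponential_zero_bias_identity[of t] mgf_zero_bias_levy_infinite[OF t(2)] t by simp
  moreover have "mgf \<mu> (\<lambda>x. x) t \<noteq> 0"
    unfolding mgf_def by (subst nn_integral_0_iff_AE) auto
  moreover have "V * t > 0" using variance_pos t by simp
  ultimately show False
    by (auto simp: ennreal_mult_less_top ennreal_mult_top ennreal_top_mult split: if_splits)
qed

text \<open>Gronwall's inequality: the truncated moment \<open>f\<close> satisfies \<open>f' \<le> K' f\<close> with \<open>K' = V * unit_cgf_deriv M p\<close> and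
\<open>f 0 = 1\<close>.\<close>
lemma truncated_exp_moment_le:
  assumes "0 < N" "0 \<le> T" "T < M"
  shows "(\<integral>x. exp (T * min x N) \<partial>\<mu>) \<le> exp (V * unit_cgf M p T)"
proof -
  define f where "f = (\<lambda>t. \<integral>x. exp (t * min x N) \<partial>\<mu>)"
  define f' where "f' = (\<lambda>t. \<integral>x. min x N * exp (t * min x N) \<partial>\<mu>)"
  have int: "integrable \<mu> (\<lambda>x. exp (t * min x N))" if "0 \<le> t" for t
    by (rule \<mu>.integrable_const_bound[where B = "exp (t * N)"])
      (use that in \<open>auto intro!: mult_left_mono\<close>)
  have int_abs: "integrable \<mu> (\<lambda>x. (\<bar>x\<bar> + N) * exp (T * N))"
    using integrable_law(1) by auto
  have bound: "norm (min x N * exp (t * min x N)) \<le> (\<bar>x\<bar> + N) * exp (T * N)" if "t \<in> {0..T}" for t x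
  proof -
    have "t * min x N \<le> t * N" using that by (intro mult_left_mono) auto
    also have "\<dots> \<le> T * N" using that assms by (intro mult_right_mono) auto
    finally have "exp (t * min x N) \<le> exp (T * N)" by simp
    moreover have "\<bar>min x N\<bar> \<le> \<bar>x\<bar> + N" using assms by (auto simp: min_def)
    ultimately show ?thesis unfolding norm_mult by (intro mult_mono) auto
  qed
  have deriv: "(f has_real_derivative f' t) (at t within {0..T})" if "t \<in> {0..T}" for t
    unfolding has_real_derivative_iff_has_vector_derivative f_def f'_def
  proof (rule has_vector_derivative_integral[OF _ that int _ bound int_abs])
    show "((\<lambda>s. exp (s * min x N)) has_vector_derivative min x N * exp (s * min x N)) (at s within {0..T})" for s x
      by (auto intro!: derivative_eq_intros simp flip: has_real_derivative_iff_has_vector_derivative)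
  qed auto
  have ineq: "f' t \<le> V * unit_cgf_deriv M p t * f t" if t: "t \<in> {0..T}" for t
  proof -
    have int': "integrable \<mu> (\<lambda>x. x * exp (t * min x N))"
    proof (rule Bochner_Integration.integrable_bound)
      show "integrable \<mu> (\<lambda>x. \<bar>x\<bar> * exp (T * N))" using integrable_law(1) by auto
      have "t * min x N \<le> T * N" for x
        using t assms by (intro order_trans[OF mult_left_mono[of "min x N" N t] mult_right_mono]) auto
      then show "AE x in \<mu>. norm (x * exp (t * min x N)) \<le> norm (\<bar>x\<bar> * exp (T * N))"
        by (auto simp: abs_mult intro!: mult_left_mono)
    qed measurable
    have nonneg: "0 \<le> x * (exp (t * min x N) - 1)" for x
      using t assms by (intro mult_exp_diff_one_nonneg) (auto simp: min_def zero_le_mult_iff)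
    have "integrable \<mu> (\<lambda>x. min x N * exp (t * min x N))"
      by (rule Bochner_Integration.integrable_bound[OF int_abs]) (use bound[OF t] assms in auto)
    \<comment> \<open>Replacing the factor \<open>min x N\<close> by \<open>x\<close> increases the integral; as \<open>X\<close> has mean zero, 1 may then be subtracted.\<close>
    then have "f' t \<le> (\<integral>x. x * exp (t * min x N) \<partial>\<mu>)"
      unfolding f'_def using int' by (rule integral_mono) (auto intro!: mult_right_mono)
    also have "\<dots> = (\<integral>x. x * (exp (t * min x N) - 1) \<partial>\<mu>)"
      using int' integrable_law by (simp add: right_diff_distrib)
    also have "\<dots> \<le> V * unit_cgf_deriv M p t * f t"
    proof (cases "t = 0")
      case False
      with t assms have t0: "0 < t" "t < M" by auto
      have f_nonneg: "0 \<le> f t" unfolding f_def by (rule Bochner_Integration.integral_nonneg) auto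
      have Q_nonneg: "0 \<le> unit_cgf_deriv M p t"
        using has_integral_nonneg[OF uniform_mixture[OF t0]] t0 by (simp add: gamma_mgf_def)
      have "ennreal (\<integral>x. x * (exp (t * min x N) - 1) \<partial>\<mu>) = (\<integral>\<^sup>+ x. ennreal (x * (exp (t * min x N) - 1)) \<partial>\<mu>)"
        using int' integrable_law nonneg
        by (intro nn_integral_eq_integral[symmetric]) (auto simp: right_diff_distrib)
      also have "\<dots> \<le> ennreal (V * t) * ((\<integral>\<^sup>+ x. ennreal (exp (t * min x N)) \<partial>\<mu>) * mgf (zero_bias levy) (\<lambda>w. w) t)"
        using t assms by (intro truncated_zero_bias_inequality AE_levy_nonneg) auto
      also have "\<dots> = ennreal (V * t) * (ennreal (f t) * ennreal (unit_cgf_deriv M p t / t))"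
        unfolding f_def mgf_zero_bias_levy[OF t0] using int t0
        by (subst nn_integral_eq_integral) auto
      also have "\<dots> = ennreal (V * t * (f t * (unit_cgf_deriv M p t / t)))"
        using f_nonneg Q_nonneg t0 variance_pos by (simp flip: ennreal_mult)
      also have "V * t * (f t * (unit_cgf_deriv M p t / t)) = V * unit_cgf_deriv M p t * f t"
        using t0 by simp
      finally show ?thesis
        using f_nonneg Q_nonneg variance_pos by (subst (asm) ennreal_le_iff) auto
    qed simp
    finally show ?thesis .
  qed
  define h where "h = (\<lambda>t. f t * exp (- (V * unit_cgf M p t)))"
  have h_deriv: "(h has_real_derivative (f' t - V * unit_cgf_deriv M p t * f t) * exp (- (V * unit_cgf M p t)))
      (at t within {0..T})" if "t \<in> {0..T}" for t
    unfolding h_def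
    by (auto intro!: derivative_eq_intros deriv[OF that] has_derivative_unit_cgf[OF assms(3) that]
        simp: algebra_simps)
  have "h T \<le> h 0"
  proof (rule DERIV_nonpos_imp_decreasing_open[OF assms(2)])
    show "continuous_on {0..T} h" using h_deriv by (rule DERIV_continuous_on)
    fix t assume t: "0 < t" "t < T"
    then have "at t within {0..T} = at t" by (rule at_within_Icc_at)
    with h_deriv[of t] t
    have "(h has_real_derivative (f' t - V * unit_cgf_deriv M p t * f t) * exp (- (V * unit_cgf M p t))) (at t)"
      by simp
    moreover have "(f' t - V * unit_cgf_deriv M p t * f t) * exp (- (V * unit_cgf M p t)) \<le> 0"
      using ineq[of t] t by (intro mult_nonpos_nonneg) auto
    ultimately show "\<exists>D. (h has_real_derivative D) (at t) \<and> D \<le> 0" by blast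
  qed
  also have "h 0 = 1" by (simp add: h_def f_def \<mu>.prob_space[simplified])
  finally show ?thesis
    by (simp add: h_def f_def exp_minus field_simps)
qed

lemma mgf_le:
  assumes "0 \<le> T" "T < M"
  shows "mgf \<mu> (\<lambda>x. x) T \<le> ennreal (exp (V * unit_cgf M p T))"
proof -
  let ?f = "\<lambda>n x. ennreal (exp (T * min x (real (Suc n))))"
  have "(\<lambda>n. \<integral>\<^sup>+ x. ?f n x \<partial>\<mu>) \<longlonglongrightarrow> (\<integral>\<^sup>+ x. ennreal (exp (T * x)) \<partial>\<mu>)"
  proof (rule nn_integral_LIMSEQ)
    show "incseq ?f"
      using assms by (auto simp: incseq_def le_fun_def intro!: ennreal_leI mult_left_mono)
    show "(\<lambda>n. ?f n x) \<longlonglongrightarrow> ennreal (exp (T * x))" for x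
    proof (rule tendsto_eventually)
      have "\<forall>\<^sub>F n in sequentially. x \<le> real n"
        by (rule eventually_sequentiallyI[of "nat \<lceil>x\<rceil>"]) linarith
      then show "\<forall>\<^sub>F n in sequentially. ?f n x = ennreal (exp (T * x))"
        by eventually_elim (simp add: min_def)
    qed
  qed measurable
  then show ?thesis unfolding mgf_def
  proof (rule LIMSEQ_le_const2, intro exI allI impI)
    fix n
    have "integrable \<mu> (\<lambda>x. exp (T * min x (real (Suc n))))"
      by (rule \<mu>.integrable_const_bound[where B = "exp (T * real (Suc n))"])
        (use assms in \<open>auto intro!: mult_left_mono simp del: of_nat_Suc\<close>)
    then have "(\<integral>\<^sup>+ x. ?f n x \<partial>\<mu>) = ennreal (\<integral>x. exp (T * min x (real (Suc n))) \<partial>\<mu>)"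
      by (intro nn_integral_eq_integral) auto
    also have "\<dots> \<le> ennreal (exp (V * unit_cgf M p T))"
      using assms by (intro ennreal_leI truncated_exp_moment_le) auto
    finally show "(\<integral>\<^sup>+ x. ?f n x \<partial>\<mu>) \<le> ennreal (exp (V * unit_cgf M p T))" .
  qed
qed

lemma integrable_exp:
  assumes "0 \<le> t" "t < M"
  shows "integrable \<mu> (\<lambda>x. exp (t * x))"
  using mgf_le[OF assms] unfolding mgf_def
  by (intro integrableI_nonneg) (auto simp: less_top[symmetric] top_unique)

text \<open>The upper bound makes all exponential moments below \<open>M\<close> finite, so that the identity becomes the differential
equation \<open>f' = K' f\<close>, with the same solution as above.\<close>
lemma mgf_eq:
  assumes "0 \<le> T" "T < M"
  shows "mgf P X T = ennreal (exp (V * unit_cgf M p T))"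
proof -
  define f where "f = (\<lambda>t. \<integral>x. exp (t * x) \<partial>\<mu>)"
  define T' where "T' = (T + M) / 2"
  have T': "T < T'" "T' < M" using assms by (auto simp: T'_def)
  define B where "B = (\<lambda>x. \<bar>x\<bar> + exp (T' * x) / (T' - T))"
  have int_B: "integrable \<mu> B"
    unfolding B_def using integrable_law(1) integrable_exp[of T'] T' assms by auto
  have bound: "norm (x * exp (t * x)) \<le> B x" if "t \<in> {0..T}" for t x
    using abs_mult_exp_le[of t T T' x] that T' by (simp add: abs_mult B_def)
  have deriv: "(f has_real_derivative (\<integral>x. x * exp (t * x) \<partial>\<mu>)) (at t within {0..T})" if "t \<in> {0..T}" for t
    unfolding has_real_derivative_iff_has_vector_derivative f_def
  proof (rule has_vector_derivative_integral[OF _ that _ _ bound int_B])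
    show "((\<lambda>s. exp (s * x)) has_vector_derivative x * exp (s * x)) (at s within {0..T})" for s x
      by (auto intro!: derivative_eq_intros simp flip: has_real_derivative_iff_has_vector_derivative)
    show "integrable \<mu> (\<lambda>x. exp (s * x))" if "s \<in> {0..T}" for s
      using that assms by (intro integrable_exp) auto
  qed auto
  have eq: "(\<integral>x. x * exp (t * x) \<partial>\<mu>) = V * unit_cgf_deriv M p t * f t" if t: "t \<in> {0..T}" for t
  proof (cases "t = 0")
    case True
    then show ?thesis using integrable_law by simp
  next
    case False
    with t assms have t0: "0 < t" "t < M" by auto
    have f_nonneg: "0 \<le> f t" unfolding f_def by (rule Bochner_Integration.integral_nonneg) auto
    have Q_nonneg: "0 \<le> unit_cgf_deriv M p t"
      using has_integral_nonneg[OF uniform_mixture[OF t0]] t0 by (simp add: gamma_mgf_def)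
    have int': "integrable \<mu> (\<lambda>x. x * exp (t * x))"
      by (rule Bochner_Integration.integrable_bound[OF int_B])
        (use bound[OF t] in \<open>auto intro: order_trans[OF _ abs_ge_self]\<close>)
    have nonneg: "0 \<le> x * (exp (t * x) - 1)" for x
      using t0 by (intro mult_exp_diff_one_nonneg) auto
    have "(\<integral>x. x * exp (t * x) \<partial>\<mu>) = (\<integral>x. x * (exp (t * x) - 1) \<partial>\<mu>)"
      using int' integrable_law by (simp add: right_diff_distrib)
    also have "ennreal \<dots> = (\<integral>\<^sup>+ x. ennreal (x * (exp (t * x) - 1)) \<partial>\<mu>)"
      using int' integrable_law nonneg
      by (intro nn_integral_eq_integral[symmetric]) (auto simp: right_diff_distrib)
    also have "\<dots> = ennreal (V * t) * (mgf \<mu> (\<lambda>x. x) t * mgf (zero_bias levy) (\<lambda>w. w) t)"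
      using t0 by (intro exponential_zero_bias_identity) auto
    also have "mgf \<mu> (\<lambda>x. x) t = ennreal (f t)"
      unfolding f_def mgf_def using integrable_exp[of t] t0 by (intro nn_integral_eq_integral) auto
    also have "mgf (zero_bias levy) (\<lambda>w. w) t = ennreal (unit_cgf_deriv M p t / t)"
      by (rule mgf_zero_bias_levy[OF t0])
    also have "ennreal (V * t) * (ennreal (f t) * ennreal (unit_cgf_deriv M p t / t))
        = ennreal (V * t * (f t * (unit_cgf_deriv M p t / t)))"
      using f_nonneg Q_nonneg t0 variance_pos by (simp flip: ennreal_mult)
    also have "V * t * (f t * (unit_cgf_deriv M p t / t)) = V * unit_cgf_deriv M p t * f t"
      using t0 by simp
    finally show ?thesis
    proof (subst (asm) ennreal_inj)
      show "0 \<le> (\<integral>x. x * exp (t * x) \<partial>\<mu>)"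
        unfolding \<open>(\<integral>x. x * exp (t * x) \<partial>\<mu>) = (\<integral>x. x * (exp (t * x) - 1) \<partial>\<mu>)\<close>
        using nonneg by (intro Bochner_Integration.integral_nonneg) auto
    qed (use f_nonneg Q_nonneg variance_pos in \<open>auto\<close>)
  qed
  define h where "h = (\<lambda>t. f t * exp (- (V * unit_cgf M p t)))"
  have "(h has_real_derivative 0) (at t within {0..T})" if "t \<in> {0..T}" for t
  proof -
    have "(f has_real_derivative V * unit_cgf_deriv M p t * f t) (at t within {0..T})"
      using deriv[OF that] unfolding eq[OF that] .
    then show ?thesis
      unfolding h_def
      by (auto intro!: derivative_eq_intros has_derivative_unit_cgf[OF assms(2) that]
          simp: algebra_simps)
  qed
  then obtain c where "\<forall>t\<in>{0..T}. h t = c"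
    using has_field_derivative_zero_constant[of "{0..T}" h] by auto
  then have "h T = h 0" using assms by simp
  also have "h 0 = 1" by (simp add: h_def f_def \<mu>.prob_space[simplified])
  finally have "f T = exp (V * unit_cgf M p T)"
    by (simp add: h_def exp_minus field_simps)
  then show ?thesis
    unfolding mgf_law[symmetric] unfolding mgf_def f_def using integrable_exp[OF assms]
    by (subst nn_integral_eq_integral) auto
qed

end

section \<open>The feasibility frontier\<close>

context tempered_stable_rv
begin

lemma cgf_eq:
  assumes "0 \<le> t" "t < M"
  shows "cgf P X t = ereal (V * unit_cgf M p t)"
  unfolding cgf_def mgf_eq[OF assms] by simp

lemma cgf_infinite: "M < t \<Longrightarrow> cgf P X t = \<infinity>"
  by (simp add: cgf_def mgf_infinite)

lemma cgf_abscissa_eq: "cgf_abscissa P X = ereal M"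
  unfolding cgf_abscissa_def
proof (rule Sup_eqI)
  fix y assume "y \<in> insert 0 {ereal t |t. 0 < t \<and> cgf P X t < \<infinity>}"
  moreover have "t \<le> M" if "cgf P X t < \<infinity>" for t
    using that cgf_infinite[of t] by (cases "M < t") auto
  ultimately show "y \<le> ereal M" using M_pos by auto
next
  fix y assume y: "\<And>z. z \<in> insert 0 {ereal t |t. 0 < t \<and> cgf P X t < \<infinity>} \<Longrightarrow> z \<le> y"
  show "ereal M \<le> y"
  proof (rule dense_le_bounded)
    show "0 < ereal M" using M_pos by simp
    fix w assume w: "0 < w" "w < ereal M"
    then obtain t where t: "w = ereal t" by (cases w) auto
    then have "cgf P X t < \<infinity>" using w by (subst cgf_eq) auto
    then show "w \<le> y" using w t by (intro y) auto
  qed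
qed

text \<open>For smaller \<open>c\<close> the interval on which the bound is required would extend beyond \<open>M\<close>, where the cumulant
generating function is infinite.\<close>
lemma feasible_imp_floor:
  assumes "feasible P X v c"
  shows "1 / M \<le> c"
proof (rule ccontr)
  assume less: "\<not> 1 / M \<le> c"
  have c: "0 \<le> c" using assms by (simp add: feasible_def)
  obtain t where t: "M < t" "c * t < 1"
  proof (cases "c = 0")
    case True
    then show ?thesis using that[of "M + 1"] by simp
  next
    case False
    then have "M < 1 / c" using less c M_pos by (simp add: field_simps)
    then obtain t where "M < t" "t < 1 / c" using dense by blast
    then show ?thesis using that[of t] False c by (simp add: field_simps)
  qed
  then have "cgf P X t \<le> ereal (v * t\<^sup>2 / (2 * (1 - c * t)))"
    using assms M_pos by (auto simp: feasible_def)
  then show False using cgf_infinite[OF t(1)] by simp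
qed

lemma feasible_iff:
  assumes "1 / M \<le> c"
  shows "feasible P X v c \<longleftrightarrow> v > 0 \<and>
    (\<forall>t>0. c * t < 1 \<longrightarrow> V * cgf_ratio M p t * (1 - c * t) \<le> v)"
proof -
  have "0 < 1 / M" using M_pos by simp
  then have c: "0 < c" using assms by linarith
  have step: "cgf P X t \<le> ereal (v * t\<^sup>2 / (2 * (1 - c * t))) \<longleftrightarrow> V * cgf_ratio M p t * (1 - c * t) \<le> v"
    if t: "0 < t" "c * t < 1" for t
  proof -
    have "t / M \<le> c * t" using assms t mult_right_mono[of "1 / M" c t] by simp
    then have tM: "t < M" using t M_pos by (auto dest: le_less_trans)
    have "V * unit_cgf M p t = V * cgf_ratio M p t * (t\<^sup>2 / 2)"
      using t by (simp add: cgf_ratio_def)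
    moreover have "v * t\<^sup>2 / (2 * (1 - c * t)) = v / (1 - c * t) * (t\<^sup>2 / 2)" by simp
    ultimately have "cgf P X t \<le> ereal (v * t\<^sup>2 / (2 * (1 - c * t))) \<longleftrightarrow>
        V * cgf_ratio M p t * (t\<^sup>2 / 2) \<le> v / (1 - c * t) * (t\<^sup>2 / 2)"
      using t tM by (simp only: cgf_eq less_imp_le ereal_less_eq)
    also have "\<dots> \<longleftrightarrow> V * cgf_ratio M p t \<le> v / (1 - c * t)"
      using t by (intro mult_le_cancel_right_pos) simp
    also have "\<dots> \<longleftrightarrow> V * cgf_ratio M p t * (1 - c * t) \<le> v"
      using t by (intro pos_le_divide_eq) simp
    finally show ?thesis .
  qed
  have zero: "cgf P X 0 \<le> ereal (v * 0\<^sup>2 / (2 * (1 - c * 0)))"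
    using M_pos by (simp add: cgf_eq)
  show ?thesis
  proof
    assume "feasible P X v c"
    then show "v > 0 \<and> (\<forall>t>0. c * t < 1 \<longrightarrow> V * cgf_ratio M p t * (1 - c * t) \<le> v)"
      using step unfolding feasible_def by auto
  next
    assume R: "v > 0 \<and> (\<forall>t>0. c * t < 1 \<longrightarrow> V * cgf_ratio M p t * (1 - c * t) \<le> v)"
    have "cgf P X t \<le> ereal (v * t\<^sup>2 / (2 * (1 - c * t)))" if "0 \<le> t" "c * t < 1" for t
      using zero step[of t] R that by (cases "t = 0") simp_all
    then show "feasible P X v c" using R c unfolding feasible_def by auto
  qed
qed

lemma feasible_mono:
  assumes "feasible P X v c" "v \<le> w"
  shows "feasible P X w c"
  using assms feasible_iff[OF feasible_imp_floor[OF assms(1)]] by (force)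

lemma c_star_le: "feasible P X v c \<Longrightarrow> c_star P X v \<le> ereal c"
  unfolding c_star_def by (rule Inf_lower) auto

lemma c_star_ge: "(\<And>c. feasible P X v c \<Longrightarrow> b \<le> c) \<Longrightarrow> ereal b \<le> c_star P X v"
  unfolding c_star_def by (rule Inf_greatest) auto

lemma c_star_floor: "ereal (1 / M) \<le> c_star P X v"
  by (rule c_star_ge) (rule feasible_imp_floor)

lemma c_star_antimono: "v \<le> w \<Longrightarrow> c_star P X w \<le> c_star P X v"
  unfolding c_star_def by (rule Inf_superset_mono) (auto intro: feasible_mono)

abbreviation "critical_scale \<equiv> max 1 (p / 3)"

text \<open>For \<open>t \<ge> M / critical_scale\<close> the left-hand side is not positive; including this range is what allows a
comparison with slightly smaller scales.\<close>
lemma ratio_scale_bound: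
  assumes "0 < t" "t < M"
  shows "cgf_ratio M p t * (1 - critical_scale * t / M) \<le> 1"
proof (cases "critical_scale * t / M < 1")
  case True
  have "p \<le> 3 * critical_scale" by (simp add: max_def)
  then have "cgf_ratio M p t \<le> 1 / (1 - critical_scale * t / M)"
    using assms True by (intro cgf_ratio_upper) auto
  then show ?thesis using True by (simp add: pos_le_divide_eq)
next
  case False
  have "cgf_ratio M p t * (1 - critical_scale * t / M) \<le> 0"
    using False one_le_cgf_ratio[OF assms] by (intro mult_nonneg_nonpos) auto
  then show ?thesis by simp
qed

lemma less_M:
  assumes "1 \<le> k" "0 < t" "k / M * t < 1"
  shows "t < M"
proof -
  have "1 * t \<le> k * t" using assms by (intro mult_right_mono) auto
  also have "\<dots> < M" using assms M_pos by (simp add: field_simps)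
  finally show ?thesis by simp
qed

lemma feasible_variance: "feasible P X V (critical_scale / M)"
proof (subst feasible_iff)
  show "1 / M \<le> critical_scale / M" using M_pos by (intro divide_right_mono) auto
  have "V * cgf_ratio M p t * (1 - critical_scale / M * t) \<le> V" if t: "0 < t" "critical_scale / M * t < 1" for t
  proof -
    have "t < M" using t by (intro less_M[of critical_scale]) auto
    then have "V * (cgf_ratio M p t * (1 - critical_scale * t / M)) \<le> V * 1"
      using variance_pos t by (intro mult_left_mono ratio_scale_bound) auto
    then show ?thesis by (simp add: mult_ac)
  qed
  then show "0 < V \<and> (\<forall>t>0. critical_scale / M * t < 1 \<longrightarrow> V * cgf_ratio M p t * (1 - critical_scale / M * t) \<le> V)"
    using variance_pos by blast
qed

text \<open>If \<open>c\<close> is below the slope \<open>a = p / (3 M)\<close> of the ratio at 0, then \<open>(1 + a t) (1 - c t) > 1\<close> for small \<open>t\<close>. The choice of \<open>t\<close> makes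
the quadratic term half the linear one.\<close>
lemma feasible_variance_imp:
  assumes "feasible P X V c"
  shows "p / 3 / M \<le> c"
proof (rule ccontr)
  assume less: "\<not> p / 3 / M \<le> c"
  define a where "a = p / 3 / M"
  have floor: "1 / M \<le> c" by (rule feasible_imp_floor[OF assms])
  then have c: "0 < c" using M_pos by (smt (verit) divide_pos_pos)
  have a: "c < a" using less by (simp add: a_def)
  define t where "t = (a - c) / (2 * a * c)"
  have t: "0 < t" using a c by (simp add: t_def)
  have ct: "c * t = (a - c) / (2 * a)" using c by (simp add: t_def)
  also have "\<dots> < 1" using a c by (simp add: field_simps)
  finally have ct1: "c * t < 1" .
  have "t / M \<le> c * t" using floor t mult_right_mono[of "1 / M" c t] by simp
  then have "t / M < 1" using ct1 by linarith
  then have tM: "t < M" using M_pos by simp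
  have "V * (cgf_ratio M p t * (1 - c * t)) \<le> V * 1"
    using assms t ct1 unfolding feasible_iff[OF floor] by (simp add: mult.assoc)
  then have "cgf_ratio M p t * (1 - c * t) \<le> 1"
    using variance_pos by (simp only: mult_le_cancel_left_pos)
  moreover have "(1 + a * t) * (1 - c * t) \<le> cgf_ratio M p t * (1 - c * t)"
    using cgf_ratio_lower[OF t tM] ct1 by (intro mult_right_mono) (auto simp: a_def)
  ultimately have "(1 + a * t) * (1 - c * t) \<le> 1" by linarith
  then have "t * (a - c - a * (c * t)) \<le> 0" by (simp add: algebra_simps)
  then have "a - c - a * (c * t) \<le> 0" using t by (simp add: mult_le_0_iff)
  moreover have "a * (c * t) = (a - c) / 2" unfolding ct using a c by simp
  ultimately show False using a by simp
qed

lemma c_star_variance: "c_star P X V = ereal (1 / M * critical_scale)"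
proof (rule antisym)
  show "c_star P X V \<le> ereal (1 / M * critical_scale)"
    using c_star_le[OF feasible_variance] by simp
  show "ereal (1 / M * critical_scale) \<le> c_star P X V"
  proof (rule c_star_ge)
    fix c assume "feasible P X V c"
    then have "1 / M \<le> c" "p / 3 / M \<le> c"
      by (rule feasible_imp_floor, rule feasible_variance_imp)
    then show "1 / M * critical_scale \<le> c" using M_pos by (auto simp: max_def)
  qed
qed

text \<open>A scale above the floor \<open>1 / M\<close> only requires the bound on \<open>t < M / k\<close>, an interval that stays away
from the singularity, where the ratio is bounded by its value at the right end point.\<close>
lemma feasible_of_scale:
  assumes k: "1 < k" and v: "V * cgf_ratio M p (M / k) \<le> v"
  shows "feasible P X v (k / M)"
proof (subst feasible_iff)
  show "1 / M \<le> k / M" using M_pos k by (intro divide_right_mono) auto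
  have Mk: "0 < M / k" "M / k < M" using k M_pos by (auto simp: field_simps)
  have le: "V * cgf_ratio M p t * (1 - k / M * t) \<le> v" if t: "0 < t" "k / M * t < 1" for t
  proof -
    have tM: "t < M" using t k by (intro less_M[of k]) auto
    have "t \<le> M / k" using t k M_pos by (simp add: field_simps)
    then have "cgf_ratio M p t \<le> cgf_ratio M p (M / k)" using t Mk by (intro cgf_ratio_mono) auto
    moreover have "cgf_ratio M p t * (1 - k / M * t) \<le> cgf_ratio M p t * 1"
      using one_le_cgf_ratio[OF t(1) tM] t k M_pos by (intro mult_left_mono) auto
    ultimately have "V * (cgf_ratio M p t * (1 - k / M * t)) \<le> V * cgf_ratio M p (M / k)"
      using variance_pos by (intro mult_left_mono) auto
    then show ?thesis using v by (simp add: mult.assoc)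
  qed
  have "0 < V * cgf_ratio M p (M / k)"
    using one_le_cgf_ratio[OF Mk] variance_pos by (intro mult_pos_pos) auto
  then show "0 < v \<and> (\<forall>t>0. k / M * t < 1 \<longrightarrow> V * cgf_ratio M p t * (1 - k / M * t) \<le> v)"
    using le v by auto
qed

text \<open>Lowering the scale from the critical value \<open>q\<close> to \<open>k\<close> raises the normalised left-hand side by
\<open>cgf_ratio M p t * (q - k) * t / M\<close>. As long as \<open>k \<ge> k1 > 1\<close> the ratio is bounded by \<open>A1\<close> on the relevant interval,
so that the increase is at most \<open>A1 * (q - k)\<close>, which the slack \<open>v - V\<close> absorbs for \<open>k\<close> close to \<open>q\<close>.\<close>
lemma c_star_strict:
  assumes Y: "Y < - 1" and v: "V < v"
  shows "c_star P X v < c_star P X V"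
proof -
  define q where "q = p / 3"
  have q: "1 < q" "critical_scale = q" using Y by (auto simp: q_def)
  define k1 where "k1 = (1 + q) / 2"
  have k1: "1 < k1" "k1 < q" using q by (auto simp: k1_def)
  have Mk: "0 < M / k1" "M / k1 < M" using k1 M_pos by (auto simp: field_simps)
  define A1 where "A1 = cgf_ratio M p (M / k1)"
  have A1: "1 \<le> A1" unfolding A1_def by (rule one_le_cgf_ratio[OF Mk])
  define e where "e = (v - V) / (V * A1)"
  have e: "0 < e" using v variance_pos A1 by (simp add: e_def)
  define k where "k = max k1 (q - e)"
  have k: "1 < k" "k1 \<le> k" "k < q" "q - k \<le> e" using k1 e by (auto simp: k_def)
  have "feasible P X v (k / M)"
  proof (subst feasible_iff)
    show "1 / M \<le> k / M" using M_pos k by (intro divide_right_mono) auto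
    have "V * cgf_ratio M p t * (1 - k / M * t) \<le> v" if t: "0 < t" "k / M * t < 1" for t
    proof -
      have tM: "t < M" using t k by (intro less_M[of k]) auto
      have "k1 * t \<le> k * t" using k t by (intro mult_right_mono) auto
      also have "\<dots> < M" using t M_pos by (simp add: field_simps)
      finally have "t \<le> M / k1" using k1 by (simp add: field_simps)
      then have "cgf_ratio M p t \<le> A1" unfolding A1_def using t Mk by (intro cgf_ratio_mono) auto
      moreover have "(q - k) * (t / M) \<le> e * 1"
        using k e t tM M_pos by (intro mult_mono) auto
      ultimately have "cgf_ratio M p t * ((q - k) * (t / M)) \<le> A1 * (e * 1)"
        by (rule mult_mono) (use A1 k t M_pos in auto)
      moreover have "cgf_ratio M p t * (1 - k / M * t)
          = cgf_ratio M p t * (1 - q * t / M) + cgf_ratio M p t * ((q - k) * (t / M))"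
        by (simp add: algebra_simps diff_divide_distrib)
      moreover have "cgf_ratio M p t * (1 - q * t / M) \<le> 1"
        using ratio_scale_bound[OF t(1) tM] q by simp
      ultimately have "cgf_ratio M p t * (1 - k / M * t) \<le> 1 + A1 * e" by linarith
      then have "V * (cgf_ratio M p t * (1 - k / M * t)) \<le> V * (1 + A1 * e)"
        using variance_pos by (intro mult_left_mono) auto
      also have "\<dots> = v"
        using A1 variance_pos by (simp add: e_def field_simps)
      finally show ?thesis by (simp only: mult.assoc)
    qed
    then show "0 < v \<and> (\<forall>t>0. k / M * t < 1 \<longrightarrow> V * cgf_ratio M p t * (1 - k / M * t) \<le> v)"
      using variance_pos v by auto
  qed
  then have "c_star P X v \<le> ereal (k / M)" by (rule c_star_le)
  also have "\<dots> < ereal (1 / M * critical_scale)" using k M_pos unfolding q(2) by (simp add: divide_strict_right_mono)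
  finally show ?thesis unfolding c_star_variance .
qed

lemma c_star_tendsto_floor: "(c_star P X \<longlongrightarrow> ereal (1 / M)) at_top"
proof (rule order_tendstoI)
  fix a assume "a < ereal (1 / M)"
  then show "\<forall>\<^sub>F v in at_top. a < c_star P X v"
    by (intro always_eventually allI less_le_trans[OF _ c_star_floor])
next
  fix a assume "ereal (1 / M) < a"
  then obtain r where r: "ereal (1 / M) < ereal r" "ereal r < a" using ereal_dense2 by blast
  define k where "k = r * M"
  have k: "1 < k" "k / M = r" using r M_pos by (auto simp: k_def field_simps)
  show "\<forall>\<^sub>F v in at_top. c_star P X v < a"
    using eventually_ge_at_top[of "V * cgf_ratio M p (M / k)"]
  proof eventually_elim
    case (elim v)
    then have "c_star P X v \<le> ereal r" using c_star_le[OF feasible_of_scale[OF k(1)]] k by simp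
    then show ?case using r by simp
  qed
qed

end

theorem proposition7p5:
  fixes Y C M V :: real and P :: "'a measure" and X :: "'a \<Rightarrow> real" and \<nu> :: "real measure"
  assumes "Y < 2" and "C > 0" and "M > 0"
    and "\<nu> = tempered_stable_levy Y C M"
    and "centered_inf_div_rv P X 0 \<nu>"
    and "V = prob_space.variance P X"
  shows "V = C * Gamma (2 - Y) * M powr (Y - 2) \<and>
    cgf_abscissa P X = ereal M \<and>
    c_star P X V = ereal (1 / M * max 1 ((2 - Y) / 3)) \<and>
    (Y \<le> - 1 \<longrightarrow> ((\<lambda>t. ereal (Psi1 0 \<nu> t)) \<longlongrightarrow> c_star P X V) (at_right 0)) \<and>
    (Y \<ge> - 1 \<longrightarrow> c_star P X V = 1 / cgf_abscissa P X) \<and>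
    (Y \<ge> - 1 \<longrightarrow> (\<forall>v\<ge>V. c_star P X v = c_star P X V)) \<and>
    (Y < - 1 \<longrightarrow> c_star P X V = ereal ((2 - Y) / (3 * M))) \<and>
    (Y < - 1 \<longrightarrow> antimono_on {V..} (c_star P X)) \<and>
    (Y < - 1 \<longrightarrow> (\<forall>v>V. c_star P X v < c_star P X V)) \<and>
    (Y < - 1 \<longrightarrow> (c_star P X \<longlongrightarrow> ereal (1 / M)) at_top)"
proof -
  interpret tempered_stable Y C M by unfold_locales fact+
  interpret tempered_stable_rv Y C M P X
    by unfold_locales (use assms levy.second_moment_pos in auto)
  have V: "V = prob_space.variance P X" by fact
  have cV: "c_star P X V = ereal (1 / M * max 1 ((2 - Y) / 3))"
    unfolding V by (rule c_star_variance)
  show ?thesis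
  proof (intro conjI impI)
    show "V = C * Gamma (2 - Y) * M powr (Y - 2)"
      using V V_eq by (simp only: levy_variance_def)
    show "cgf_abscissa P X = ereal M" by (rule cgf_abscissa_eq)
    show "c_star P X V = ereal (1 / M * max 1 ((2 - Y) / 3))" by (rule cV)
    show "((\<lambda>t. ereal (Psi1 0 \<nu> t)) \<longlongrightarrow> c_star P X V) (at_right 0)" if "Y \<le> - 1"
      using Psi1_tendsto[OF that] that unfolding assms(4) cV by (simp add: max_def mult.commute)
    show "c_star P X V = 1 / cgf_abscissa P X" if "Y \<ge> - 1"
      using that M_pos unfolding cV cgf_abscissa_eq by (simp add: max_def one_ereal_def)
    show "\<forall>v\<ge>V. c_star P X v = c_star P X V" if "Y \<ge> - 1"
    proof (intro allI impI antisym)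
      fix v assume "V \<le> v"
      then show "c_star P X v \<le> c_star P X V" by (rule c_star_antimono)
      have "c_star P X V = ereal (1 / M)" using that unfolding cV by (simp add: max_def)
      then show "c_star P X V \<le> c_star P X v" using c_star_floor by simp
    qed
    show "c_star P X V = ereal ((2 - Y) / (3 * M))" if "Y < - 1"
      using that unfolding cV by (simp add: max_def)
    show "antimono_on {V..} (c_star P X)" by (rule monotone_onI) (rule c_star_antimono)
    show "\<forall>v>V. c_star P X v < c_star P X V" if "Y < - 1"
      using c_star_strict[OF that] unfolding V by blast
    show "(c_star P X \<longlongrightarrow> ereal (1 / M)) at_top" by (rule c_star_tendsto_floor)
  qed
qed

end
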